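(* Let $\mathcal{D}=\{X\in\mathcal{S}_+^n:\ \operatorname{rank}(X)\le k,\ f(\lambda(X))\le 0\}$ and let $\tilde k\le k$ be its strengthened rank. Consider $$V_{\rm opt}:=\min_{X\in\mathcal{D}}\{\langle A_0,X\rangle:\ b_i^l\le\langle A_i,X\rangle\le b_i^u,\ \forall i\in[m]\}\quad\text{(LSOP)},$$ $$V_{\rm rel}:=\min_{X\in\operatorname{conv}(\mathcal{D})}\{\langle A_0,X\rangle:\ b_i^l\le\langle A_i,X\rangle\le b_i^u,\ \forall i\in[m]\}\quad\text{(LSOP-R)},$$ and let $\tilde m$ be the number of linearly independent matrices among $A_1,\dots,A_m$. If $\tilde m\le (k-\tilde k+2)(k-\tilde k+3)/2-2$, then: (i) every extreme point of the feasible set of LSOP-R has rank at most $k$; and (ii) LSOP-R achieves the same optimal value as LSOP, i.e., $V_{\rm opt}=V_{\rm rel}$, if LSOP-R yields a finite optimal value, i.e., $V_{\rm rel}>-\infty$.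
   Context: $k\le n$ are positive integers; $[m]=\{1,\dots,m\}$; $\mathcal{S}_+^n$ is the set of $n\times n$ real symmetric positive semidefinite matrices; $\langle\cdot,\cdot\rangle$ is the Frobenius inner product; $\operatorname{conv}$ denotes convex hull. $\lambda(X)\in\mathbb{R}^n$ is the vector of eigenvalues of $X$. The function $f:\mathbb{R}^n\to\mathbb{R}$ is continuous, convex and symmetric (invariant under permutations of its arguments). $A_0,A_1,\dots,A_m$ are real symmetric $n\times n$ matrices and $-\infty\le b_i^l\le b_i^u\le+\infty$. The number $\tilde m$ is the dimension of the linear span of $\{A_i\}_{i\in[m]}$. Strengthened rank: $\tilde k$ with $1\le\tilde k\le k$ is the smallest integer such that $\operatorname{conv}(\mathcal{D})=\operatorname{conv}(\{X\in\mathcal{S}_+^n:\ \operatorname{rank}(X)\le\tilde k,\ f(\lambda(X))\le0\})$. *)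

theory Defs
  imports "HOL-Analysis.Analysis"
begin

definition symmetric_matrix :: "real^'n^'n \<Rightarrow> bool" where
  "symmetric_matrix X \<longleftrightarrow> transpose X = X"

definition psd_cone :: "(real^'n^'n) set" where
  "psd_cone = {X. symmetric_matrix X \<and> (\<forall>v. 0 \<le> v \<bullet> (X *v v))}"

text \<open>
  The eigenvalues of a real symmetric matrix with multiplicity, i.e. the roots of its characteristic
  polynomial (\<^term>\<open>mat t\<close> is \<open>t\<close> times the identity). The vector is determined up to the
  order of its entries only, so it should be used only as an argument of symmetric functions;
  on a matrix whose characteristic polynomial does not split over the reals it is unspecified.
\<close>

definition eigenvalue_vector :: "real^'n^'n \<Rightarrow> real^'n" where
  "eigenvalue_vector X = (SOME l. \<forall>t. det (mat t - X) = (\<Prod>i\<in>UNIV. t - l $ i))"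

definition symmetric_function :: "(real^'n \<Rightarrow> real) \<Rightarrow> bool" where
  "symmetric_function f \<longleftrightarrow> (\<forall>p. p permutes (UNIV :: 'n set) \<longrightarrow> (\<forall>x. f (\<chi> i. x $ p i) = f x))"

definition spectral_domain :: "(real^'n \<Rightarrow> real) \<Rightarrow> nat \<Rightarrow> (real^'n^'n) set" where
  "spectral_domain f k = {X \<in> psd_cone. rank X \<le> k \<and> f (eigenvalue_vector X) \<le> 0}"

definition strengthened_rank :: "(real^'n \<Rightarrow> real) \<Rightarrow> nat \<Rightarrow> nat" where
  "strengthened_rank f k =
     (LEAST r. 1 \<le> r \<and> r \<le> k \<and>
        convex hull (spectral_domain f k) = convex hull (spectral_domain f r))"

text \<open>
  On \<^typ>\<open>real^'n^'n\<close> the inner product \<open>A \<bullet> X\<close> is the sum of all products of corresponding entries,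
  i.e. the Frobenius inner product.
\<close>

definition feasible_set ::
  "(real^'n^'n) set \<Rightarrow> (nat \<Rightarrow> real^'n^'n) \<Rightarrow> (nat \<Rightarrow> ereal) \<Rightarrow> (nat \<Rightarrow> ereal) \<Rightarrow> nat \<Rightarrow> (real^'n^'n) set"
  where
  "feasible_set S A bl bu m =
     {X \<in> S. \<forall>i\<in>{1..m}. bl i \<le> ereal (A i \<bullet> X) \<and> ereal (A i \<bullet> X) \<le> bu i}"

text \<open>
  The optimal value is an infimum in the extended reals: \<open>\<infinity>\<close> for an infeasible problem,
  \<open>-\<infinity>\<close> for an unbounded one, and not required to be attained.
\<close>

definition optimal_value ::
  "(real^'n^'n) set \<Rightarrow> (nat \<Rightarrow> real^'n^'n) \<Rightarrow> (nat \<Rightarrow> ereal) \<Rightarrow> (nat \<Rightarrow> ereal) \<Rightarrow> nat \<Rightarrow> ereal" where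
  "optimal_value S A bl bu m = (INF X\<in>feasible_set S A bl bu m. ereal (A 0 \<bullet> X))"

end

theory Submission
  imports Defs
begin

text \<open>
  The convex hull of the spectral domain with rank bound \<open>r\<close> is the union, over all sparse vectors
  \<open>x \<ge> 0\<close> with at most \<open>r\<close> nonzero entries and \<open>f x \<le> 0\<close>, of the orbit hulls
  \<open>Ky_Fan_body x\<close>: the symmetric matrices whose eigenvalue vector is majorized by \<open>x\<close>
  (\<open>hull_subset_Ky_Fan_bodies\<close>, \<open>Ky_Fan_body_subset_hull\<close>). That an orbit hull lies in the convex hull is
  Rado's theorem; that the union is convex holds because majorizing vectors may be permuted until they are
  sorted alike, and the sums of largest entries are additive on vectors sorted alike. Since \<open>f\<close> is
  symmetric and convex, it is monotone under majorization, so a matrix of the hull lies in the domain itself as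
  soon as its rank is at most \<open>k\<close> (\<open>low_rank_in_Ky_Fan_body\<close>).

  By the definition of the strengthened rank one may take \<open>r = kt\<close>. Let \<open>X\<close> in \<open>Ky_Fan_body x\<close> have rank
  larger than \<open>k\<close>, and let \<open>y\<close> be its eigenvalue vector. As \<open>y\<close> has more nonzero entries
  than \<open>x\<close>, the majorization inequalities leave room: there is a block of at least \<open>k - kt + 2\<close>
  eigenvectors such that every partial sum of \<open>y\<close> that cuts the block is strictly below its bound
  (\<open>slack_block_exists\<close>). A small symmetric perturbation of trace 0 supported on the block
  therefore stays in the orbit hull (\<open>block_perturbation_in_Ky_Fan_body\<close>). The space of these
  perturbations has dimension at least \<open>(k - kt + 2) * (k - kt + 3) / 2 - 1\<close>, which exceeds the number
  of independent constraints, so one of them is orthogonal to all constraints and \<open>X\<close> is the midpoint of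
  a feasible segment (\<open>high_rank_segment_in_Ky_Fan_body\<close>). Hence extreme points have rank at most \<open>k\<close>.

  For the optimal values, let \<open>X\<close> be feasible for the relaxation and in \<open>Ky_Fan_body x\<close>. This body is compact,
  so the objective attains its minimum on the feasible part of the body at an extreme point of that part.
  The same perturbation argument bounds the rank of this point by \<open>k\<close>, so it lies in the
  original domain, and its value is at most that of \<open>X\<close>.
\<close>

section \<open>Partial sums and majorization\<close>

text \<open>
  Both sums have total weight \<open>card T\<close>, so \<open>x\<close> may be replaced by \<open>x - \<tau>\<close> for a threshold \<open>\<tau>\<close>
  that separates the values on \<open>T\<close> from those off \<open>T\<close>; then the inequality holds term by term.
\<close>

lemma fractional_knapsack:
  fixes w x :: "'a \<Rightarrow> real"
  assumes "finite B" and "T \<subseteq> B" and top: "\<And>i j. i \<in> T \<Longrightarrow> j \<in> B - T \<Longrightarrow> x j \<le> x i"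
    and w: "\<And>i. i \<in> B \<Longrightarrow> 0 \<le> w i \<and> w i \<le> 1" and tot: "sum w B = card T"
  shows "(\<Sum>i\<in>B. w i * x i) \<le> (\<Sum>i\<in>T. x i)"
proof -
  have fT: "finite T" using assms(1,2) finite_subset by blast
  obtain \<tau> where \<tau>: "\<And>i. i \<in> T \<Longrightarrow> \<tau> \<le> x i" "\<And>j. j \<in> B - T \<Longrightarrow> x j \<le> \<tau>"
  proof (cases "T = {}")
    case True
    show ?thesis
    proof (rule that[of "Max (x ` B)"])
      fix j assume "j \<in> B - T"
      then show "x j \<le> Max (x ` B)" using \<open>finite B\<close> by simp
    qed (use True in simp)
  next
    case False
    have "Min (x ` T) \<in> x ` T" using False fT by simp
    then obtain i where i: "i \<in> T" "x i = Min (x ` T)" by auto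
    show ?thesis
    proof (rule that[of "x i"])
      show "x i \<le> x j" if "j \<in> T" for j using i that fT by simp
      show "x j \<le> x i" if "j \<in> B - T" for j using top i that by blast
    qed
  qed
  let ?u = "\<lambda>i. if i \<in> T then 1 else (0::real)"
  have inT: "(\<Sum>i\<in>B. ?u i * g i) = (\<Sum>i\<in>T. g i)" for g :: "'a \<Rightarrow> real"
  proof -
    have "(\<Sum>i\<in>B. ?u i * g i) = (\<Sum>i\<in>B. if i \<in> T then g i else 0)"
      by (intro sum.cong) auto
    also have "\<dots> = sum g (B \<inter> T)" using \<open>finite B\<close> by (simp add: sum.inter_restrict)
    finally show ?thesis using \<open>T \<subseteq> B\<close> by (simp add: Int_absorb1)
  qed
  have "(\<Sum>i\<in>B. (w i - ?u i) * (x i - \<tau>)) \<le> 0"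
  proof (rule sum_nonpos)
    fix i assume "i \<in> B"
    then show "(w i - ?u i) * (x i - \<tau>) \<le> 0"
      using w[of i] \<tau>(1)[of i] \<tau>(2)[of i] by (cases "i \<in> T") (simp_all add: mult_le_0_iff)
  qed
  moreover have "(\<Sum>i\<in>B. (w i - ?u i) * (x i - \<tau>)) = (\<Sum>i\<in>B. w i * x i) - (\<Sum>i\<in>B. ?u i * x i)
     - \<tau> * (sum w B - (\<Sum>i\<in>B. ?u i * 1))"
    by (simp add: algebra_simps sum.distrib sum_subtractf sum_distrib_left)
  ultimately show ?thesis using inT[of x] inT[of "\<lambda>_. 1"] tot by simp
qed

text \<open>
  Among the sets of size \<open>l\<close> one of largest value has the threshold property, since exchanging one
  element cannot improve it.
\<close>

lemma fractional_knapsack_ex: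
  fixes w x :: "'a \<Rightarrow> real"
  assumes "finite B" and w: "\<And>i. i \<in> B \<Longrightarrow> 0 \<le> w i \<and> w i \<le> 1" and tot: "sum w B = real l"
  shows "\<exists>T\<subseteq>B. card T = l \<and> (\<Sum>i\<in>B. w i * x i) \<le> (\<Sum>i\<in>T. x i)"
proof -
  have "sum w B \<le> (\<Sum>i\<in>B. 1)" by (intro sum_mono) (use w in auto)
  then have l: "l \<le> card B" using tot by simp
  let ?C = "{T. T \<subseteq> B \<and> card T = l}"
  have fin: "finite ?C" using \<open>finite B\<close> by simp
  have ne: "?C \<noteq> {}" using obtain_subset_with_card_n[OF l] by blast
  obtain T where T: "T \<in> ?C" and max: "\<And>U. U \<in> ?C \<Longrightarrow> sum x U \<le> sum x T"
  proof -
    have "Max (sum x ` ?C) \<in> sum x ` ?C" using fin ne by simp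
    then obtain T where "T \<in> ?C" "sum x T = Max (sum x ` ?C)" by auto
    with fin show thesis by (intro that[of T]) simp_all
  qed
  have fT: "finite T" using T \<open>finite B\<close> finite_subset by blast
  have top: "x j \<le> x i" if "i \<in> T" "j \<in> B - T" for i j
  proof -
    let ?U = "insert j (T - {i})"
    have "card ?U = Suc (card (T - {i}))" using that fT by simp
    also have "\<dots> = l" using card_Suc_Diff1[OF fT, of i] that T by simp
    finally have "card ?U = l" .
    then have "sum x ?U \<le> sum x T" using T that by (intro max) auto
    moreover have "sum x ?U = x j + sum x (T - {i})" using that fT by simp
    moreover have "sum x T = x i + sum x (T - {i})" using that fT by (simp add: sum.remove)
    ultimately show ?thesis by simp
  qed
  show ?thesis
    using fractional_knapsack[of B T x w] T top w tot \<open>finite B\<close> by blast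
qed

definition topsum :: "real^'n \<Rightarrow> nat \<Rightarrow> real" where
  "topsum x l = Max ((\<lambda>T. \<Sum>i\<in>T. x $ i) ` {T. card T = l})"

text \<open>
  Majorization without sorting: bounding every partial sum of \<open>y\<close> by the best partial sum of
  \<open>x\<close> of the same size is the usual condition on decreasing rearrangements. In this form \<open>y\<close> lies in
  the base polytope of the set function \<open>\<lambda>S. topsum x (card S)\<close>, whose submodularity is used below.
\<close>

definition majorized :: "real^'n \<Rightarrow> real^'n \<Rightarrow> bool" where
  "majorized y x \<longleftrightarrow> (\<Sum>i\<in>UNIV. y $ i) = (\<Sum>i\<in>UNIV. x $ i) \<and> (\<forall>S. (\<Sum>i\<in>S. y $ i) \<le> topsum x (card S))"

lemma sum_le_topsum: "(\<Sum>i\<in>T. x $ i) \<le> topsum x (card T)" for x :: "real^'n"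
  unfolding topsum_def by (rule Max_ge) auto

lemma topsum_attained:
  fixes x :: "real^'n"
  assumes "l \<le> CARD('n)"
  obtains T where "card T = l" "topsum x l = (\<Sum>i\<in>T. x $ i)"
proof -
  obtain T0 :: "'n set" where "card T0 = l" using obtain_subset_with_card_n[OF assms] by auto
  then have "topsum x l \<in> (\<lambda>T. \<Sum>i\<in>T. x $ i) ` {T. card T = l}"
    unfolding topsum_def by (intro Max_in) auto
  then show thesis using that by auto
qed

lemma topsum_permute:
  fixes x :: "real^'n" and p :: "'n \<Rightarrow> 'n"
  assumes "bij p" and "l \<le> CARD('n)"
  shows "topsum (\<chi> i. x $ p i) l = topsum x l"
proof -
  have le: "topsum (\<chi> i. x $ p i) l \<le> topsum x l" if "bij p" for x :: "real^'n" and p :: "'n \<Rightarrow> 'n"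
  proof -
    obtain T where T: "card T = l" "topsum (\<chi> i. x $ p i) l = (\<Sum>i\<in>T. x $ p i)"
      using topsum_attained[OF assms(2), of "\<chi> i. x $ p i"] by auto
    have inj: "inj_on p T" using \<open>bij p\<close> by (meson bij_def inj_on_subset top_greatest)
    show ?thesis
      using sum_le_topsum[of x "p ` T"] T inj by (simp add: card_image sum.reindex)
  qed
  have "topsum x l = topsum (\<chi> i. (\<chi> i. x $ p i) $ inv p i) l"
    using \<open>bij p\<close> by (simp add: bij_is_surj surj_f_inv_f)
  then show ?thesis
    using le[OF \<open>bij p\<close>, of x] le[OF bij_imp_bij_inv[OF \<open>bij p\<close>], of "\<chi> i. x $ p i"] by simp
qed

lemma majorized_permute:
  fixes x :: "real^'n" and p :: "'n \<Rightarrow> 'n"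
  assumes "bij p"
  shows "majorized y (\<chi> i. x $ p i) \<longleftrightarrow> majorized y x"
  using sum.reindex_bij_betw[OF assms, of "\<lambda>i. x $ i"]
  by (simp add: majorized_def topsum_permute[OF assms] card_mono)

lemma majorized_trans:
  assumes "majorized z y" "majorized y x"
  shows "majorized z x"
  unfolding majorized_def
proof (intro conjI allI)
  show "(\<Sum>i\<in>UNIV. z $ i) = (\<Sum>i\<in>UNIV. x $ i)" using assms by (simp add: majorized_def)
  fix S :: "'a set"
  obtain T where T: "card T = card S" "topsum y (card S) = (\<Sum>i\<in>T. y $ i)"
    using topsum_attained[of "card S" y, OF card_mono[OF finite subset_UNIV]] by blast
  have "(\<Sum>i\<in>S. z $ i) \<le> topsum y (card S)" using assms(1) by (simp add: majorized_def)
  also have "\<dots> \<le> topsum x (card T)" using assms(2) unfolding majorized_def T(2) by blast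
  finally show "(\<Sum>i\<in>S. z $ i) \<le> topsum x (card S)" using T by simp
qed

text \<open>
  Only cardinalities matter, so this is concavity of \<open>topsum x\<close>. Take optimal sets \<open>U\<close> and \<open>V\<close> for
  the union and the intersection; moving elements of \<open>U - V\<close> from \<open>U\<close> to \<open>V\<close> until both
  have the intermediate sizes leaves the total value unchanged.
\<close>

lemma topsum_submodular:
  fixes x :: "real^'n" and S T :: "'n set"
  shows "topsum x (card (S \<union> T)) + topsum x (card (S \<inter> T)) \<le> topsum x (card S) + topsum x (card T)"
proof -
  obtain U where U: "card U = card (S \<union> T)" "topsum x (card (S \<union> T)) = (\<Sum>i\<in>U. x $ i)"
    using topsum_attained[of "card (S \<union> T)" x, OF card_mono[OF finite subset_UNIV]] by blast
  obtain V where V: "card V = card (S \<inter> T)" "topsum x (card (S \<inter> T)) = (\<Sum>i\<in>V. x $ i)"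
    using topsum_attained[of "card (S \<inter> T)" x, OF card_mono[OF finite subset_UNIV]] by blast
  have cST: "card S + card T = card U + card V"
    using card_Un_Int[of S T] U V by simp
  have cS: "card V \<le> card S" using V by (simp add: card_mono)
  have cT: "card S \<le> card U" using U by (simp add: card_mono)
  have "card U - card V \<le> card (U - V)" by (simp add: diff_card_le_card_Diff)
  then have "card S - card V \<le> card (U - V)" using cT by linarith
  then obtain M where M: "M \<subseteq> U - V" "card M = card S - card V"
    by (rule obtain_subset_with_card_n)
  have "card (V \<union> M) = card V + card M" using M by (intro card_Un_disjoint) auto
  then have 1: "card (V \<union> M) = card S" using M cS by simp
  have "card (U - M) = card U - card M" using M by (intro card_Diff_subset) auto
  then have 2: "card (U - M) = card T" using M cS cT cST by simp
  have "(\<Sum>i\<in>V \<union> M. x $ i) = (\<Sum>i\<in>V. x $ i) + (\<Sum>i\<in>M. x $ i)"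
    using M by (intro sum.union_disjoint) auto
  moreover have "(\<Sum>i\<in>U. x $ i) = (\<Sum>i\<in>U - M. x $ i) + (\<Sum>i\<in>M. x $ i)"
    using M by (intro sum.subset_diff) auto
  ultimately show ?thesis
    using U V sum_le_topsum[of x "V \<union> M"] sum_le_topsum[of x "U - M"] 1 2 by simp
qed

lemma topsum_eq_sum:
  fixes x :: "real^'n"
  assumes "\<And>i. 0 \<le> x $ i" and "card {i. x $ i \<noteq> 0} \<le> l" and "l \<le> CARD('n)"
  shows "topsum x l = (\<Sum>i\<in>UNIV. x $ i)"
proof (rule antisym)
  show "topsum x l \<le> (\<Sum>i\<in>UNIV. x $ i)"
    using topsum_attained[OF assms(3), of x] assms(1) by (metis finite sum_mono2 top_greatest)
  obtain T where T: "{i. x $ i \<noteq> 0} \<subseteq> T" "card T = l"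
    using exists_subset_between[of "{i. x $ i \<noteq> 0}" l UNIV] assms by auto
  have "(\<Sum>i\<in>T. x $ i) = (\<Sum>i\<in>UNIV. x $ i)"
    by (rule sum.mono_neutral_left) (use T in auto)
  then show "(\<Sum>i\<in>UNIV. x $ i) \<le> topsum x l" using sum_le_topsum[of x T] T by simp
qed

lemma majorized_nonneg:
  fixes x y :: "real^'n"
  assumes "majorized y x" and "\<And>i. 0 \<le> x $ i"
  shows "0 \<le> y $ i"
proof -
  obtain T where T: "card T = card (UNIV - {i})" "topsum x (card (UNIV - {i})) = (\<Sum>i\<in>T. x $ i)"
    by (rule topsum_attained[of "card (UNIV - {i})" x]) (simp add: card_mono)
  have "(\<Sum>j\<in>UNIV - {i}. y $ j) \<le> (\<Sum>j\<in>T. x $ j)" using assms(1) T by (metis majorized_def)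
  also have "\<dots> \<le> (\<Sum>j\<in>UNIV. x $ j)" using assms(2) by (intro sum_mono2) auto
  also have "\<dots> = (\<Sum>j\<in>UNIV. y $ j)" using assms(1) by (simp add: majorized_def)
  also have "\<dots> = y $ i + (\<Sum>j\<in>UNIV - {i}. y $ j)" by (simp add: sum.remove)
  finally show ?thesis by simp
qed

text \<open>
  Call a set tight if its inequality \<open>sum y S \<le> topsum x (card S)\<close> is an equality. By submodularity
  the tight sets are closed under union and intersection. The support \<open>P\<close> of \<open>y\<close> is tight. With a
  maximal tight proper subset \<open>J\<close> of \<open>P\<close>, every tight set either contains \<open>P - J\<close> or is
  disjoint from it, so the coordinates in \<open>P - J\<close> can be perturbed jointly as long as their sum is kept.
  The set \<open>J\<close> has fewer than \<open>r\<close> elements, because \<open>topsum x\<close> reaches the total sum at \<open>r\<close>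
  while \<open>y\<close> still has positive mass outside \<open>J\<close>.
\<close>

lemma slack_block_exists:
  fixes x y :: "real^'n"
  assumes maj: "majorized y x" and x: "\<And>i. 0 \<le> x $ i" "card {i. x $ i \<noteq> 0} \<le> r"
    and r: "r < card {i. y $ i \<noteq> 0}"
  obtains B where "card {i. y $ i \<noteq> 0} < card B + r"
    "\<And>S. S \<inter> B \<noteq> {} \<Longrightarrow> \<not> B \<subseteq> S \<Longrightarrow> (\<Sum>i\<in>S. y $ i) < topsum x (card S)"
proof -
  define P where "P = {i. y $ i \<noteq> 0}"
  define tight where "tight = (\<lambda>S. (\<Sum>i\<in>S. y $ i) = topsum x (card S))"
  have y: "0 \<le> y $ i" for i using majorized_nonneg[OF maj x(1)] .
  have le: "(\<Sum>i\<in>S. y $ i) \<le> topsum x (card S)" for S using maj by (simp add: majorized_def)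
  have lattice: "tight (S \<inter> T)" "tight (S \<union> T)" if "tight S" "tight T" for S T
  proof -
    have "(\<Sum>i\<in>S \<union> T. y $ i) + (\<Sum>i\<in>S \<inter> T. y $ i) = (\<Sum>i\<in>S. y $ i) + (\<Sum>i\<in>T. y $ i)"
      by (simp add: sum.union_inter)
    with topsum_submodular[of x S T] le[of "S \<union> T"] le[of "S \<inter> T"] that
    show "tight (S \<inter> T)" "tight (S \<union> T)" unfolding tight_def by linarith+
  qed
  have sumP: "(\<Sum>i\<in>P. y $ i) = (\<Sum>i\<in>UNIV. x $ i)"
  proof -
    have "(\<Sum>i\<in>P. y $ i) = (\<Sum>i\<in>UNIV. y $ i)"
      by (rule sum.mono_neutral_left) (auto simp: P_def)
    then show ?thesis using maj by (simp add: majorized_def)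
  qed
  have large: "topsum x l = (\<Sum>i\<in>UNIV. x $ i)" if "r \<le> l" "l \<le> CARD('n)" for l
    using topsum_eq_sum[of x l] x that by simp
  have tP: "tight P"
    using large[of "card P"] r sumP by (simp add: tight_def P_def card_mono)
  let ?C = "{S. tight S \<and> S \<subset> P}"
  have "topsum x 0 = 0" using topsum_attained[of 0 x] by auto
  then have t0: "tight {}" by (simp add: tight_def)
  have Pne: "P \<noteq> {}" using r unfolding P_def by (metis card.empty not_less0)
  have "\<exists>J\<in>?C. \<forall>S\<in>?C. card S \<le> card J"
  proof -
    have fin: "finite (card ` ?C)" by simp
    moreover have "card ` ?C \<noteq> {}" using t0 Pne by blast
    ultimately have "Max (card ` ?C) \<in> card ` ?C" by (rule Max_in)
    then obtain J where J: "J \<in> ?C" "card J = Max (card ` ?C)" by (metis (no_types, lifting) imageE)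
    then show ?thesis using fin by (metis (no_types, lifting) Max_ge imageI)
  qed
  then obtain J where J: "tight J" "J \<subset> P" and Jmax: "\<And>S. tight S \<Longrightarrow> S \<subset> P \<Longrightarrow> card S \<le> card J"
    by auto
  have Jr: "card J < r"
  proof (rule ccontr)
    assume "\<not> card J < r"
    then have "(\<Sum>i\<in>J. y $ i) = (\<Sum>i\<in>P. y $ i)"
      using J large[of "card J"] sumP by (simp add: tight_def card_mono)
    moreover have "(\<Sum>i\<in>J. y $ i) < (\<Sum>i\<in>P. y $ i)"
    proof -
      obtain i where i: "i \<in> P - J" using J by blast
      show ?thesis
        by (rule sum_strict_mono2[of P J i]) (use i J y in \<open>auto simp: P_def less_le\<close>)
    qed
    ultimately show False by simp
  qed
  show thesis
  proof (rule that[of "P - J"])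
    have "card (P - J) = card P - card J" using J by (intro card_Diff_subset) auto
    then show "card {i. y $ i \<noteq> 0} < card (P - J) + r" using Jr r by (simp add: P_def)
  next
    fix S assume S: "S \<inter> (P - J) \<noteq> {}" "\<not> P - J \<subseteq> S"
    have "\<not> tight S"
    proof
      assume "tight S"
      then have t: "tight ((S \<inter> P) \<union> J)" using lattice tP J by blast
      have "J \<subset> (S \<inter> P) \<union> J" using S by blast
      then have "card J < card ((S \<inter> P) \<union> J)" by (simp add: psubset_card_mono)
      moreover have "(S \<inter> P) \<union> J \<subset> P" using S J by blast
      ultimately show False using Jmax[OF t] by simp
    qed
    then show "(\<Sum>i\<in>S. y $ i) < topsum x (card S)" using le[of S] by (simp add: tight_def)
  qed
qed

section \<open>Rado's theorem\<close>

definition sorts :: "(nat \<Rightarrow> 'n::finite) \<Rightarrow> real^'n \<Rightarrow> bool" where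
  "sorts e x \<longleftrightarrow> bij_betw e {..<CARD('n)} UNIV \<and> (\<forall>j<CARD('n). \<forall>i\<le>j. x $ e j \<le> x $ e i)"

lemma sorts_exists:
  fixes x :: "real^'n"
  obtains e where "sorts e x"
proof -
  obtain xs0 :: "'n list" where xs0: "set xs0 = UNIV" "distinct xs0"
    using finite_distinct_list[of "UNIV :: 'n set"] by auto
  define xs where "xs = sort_key (\<lambda>i. - x $ i) xs0"
  have xs: "set xs = UNIV" "distinct xs" using xs0 by (simp_all add: xs_def)
  then have len: "length xs = CARD('n)" by (metis distinct_card)
  have "bij_betw ((!) xs) {..<CARD('n)} UNIV"
    using bij_betw_nth[of xs "{..<CARD('n)}" UNIV] xs len by simp
  moreover have "x $ (xs ! j) \<le> x $ (xs ! i)" if "j < CARD('n)" "i \<le> j" for i j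
  proof -
    have "sorted (map (\<lambda>i. - x $ i) xs)" unfolding xs_def by simp
    then have "map (\<lambda>i. - x $ i) xs ! i \<le> map (\<lambda>i. - x $ i) xs ! j"
      using that len by (intro sorted_nth_mono) auto
    then show ?thesis using that len by simp
  qed
  ultimately show thesis by (intro that[of "(!) xs"]) (simp add: sorts_def)
qed

lemma topsum_sorts:
  fixes x :: "real^'n"
  assumes "sorts e x" and "l \<le> CARD('n)"
  shows "topsum x l = (\<Sum>i<l. x $ e i)"
proof -
  have bij: "bij_betw e {..<CARD('n)} UNIV" and mono: "\<And>i j. j < CARD('n) \<Longrightarrow> i \<le> j \<Longrightarrow> x $ e j \<le> x $ e i"
    using assms by (auto simp: sorts_def)
  have inj: "inj_on e {..<l}" using bij assms(2) by (auto simp: bij_betw_def inj_on_def)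
  have T: "card (e ` {..<l}) = l" "(\<Sum>i\<in>e ` {..<l}. x $ i) = (\<Sum>i<l. x $ e i)"
    using inj by (simp_all add: card_image sum.reindex)
  have top: "x $ j \<le> x $ i" if ij: "i \<in> e ` {..<l}" "j \<in> UNIV - e ` {..<l}" for i j
  proof -
    obtain a where a: "i = e a" "a < l" using ij(1) by blast
    obtain b where b: "j = e b" "b < CARD('n)" using bij by (metis UNIV_I bij_betw_def imageE lessThan_iff)
    have "\<not> b < l" using ij b by auto
    then show ?thesis using a b mono[of b a] by simp
  qed
  obtain U where U: "card U = l" "topsum x l = (\<Sum>i\<in>U. x $ i)" by (rule topsum_attained[OF assms(2)])
  have "(\<Sum>i\<in>U. x $ i) = (\<Sum>i\<in>UNIV. if i \<in> U then x $ i else 0)"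
    by (simp add: sum.If_cases)
  also have "\<dots> = (\<Sum>i\<in>UNIV. (if i \<in> U then 1 else 0) * x $ i)"
    by (intro sum.cong) auto
  also have "\<dots> \<le> (\<Sum>i\<in>e ` {..<l}. x $ i)"
    by (rule fractional_knapsack) (use top T U in \<open>auto simp: sum.If_cases\<close>)
  finally show ?thesis using U T sum_le_topsum[of x "e ` {..<l}"] by simp
qed

lemma sort_along:
  fixes x :: "real^'n"
  assumes e: "bij_betw e {..<CARD('n)} UNIV"
  obtains p where "p permutes UNIV" "sorts e (\<chi> i. x $ p i)"
proof -
  obtain e' where e': "sorts e' x" by (rule sorts_exists)
  define p where "p = e' \<circ> inv_into {..<CARD('n)} e"
  have "bij p"
    unfolding p_def using e e' by (meson bij_betw_inv_into bij_betw_trans sorts_def)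
  then have "p permutes UNIV" by (intro bij_imp_permutes) auto
  moreover have "p (e i) = e' i" if "i < CARD('n)" for i
    using that e by (simp add: p_def bij_betw_inv_into_left)
  then have "sorts e (\<chi> i. x $ p i)" using e e' by (simp add: sorts_def)
  ultimately show thesis by (rule that)
qed

text \<open>
  Vectors that are sorted by the same enumeration have a common optimal set of each size, so
  \<^const>\<open>topsum\<close>, which in general is only subadditive, is additive on them.
\<close>

lemma topsum_add_comonotone:
  fixes x z :: "real^'n"
  assumes "sorts e x" "sorts e z" "0 \<le> a" "0 \<le> b" "l \<le> CARD('n)"
  shows "topsum (a *\<^sub>R x + b *\<^sub>R z) l = a * topsum x l + b * topsum z l"
proof -
  have s: "sorts e (a *\<^sub>R x + b *\<^sub>R z)"
    using assms by (auto simp: sorts_def intro!: add_mono mult_left_mono)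
  show "topsum (a *\<^sub>R x + b *\<^sub>R z) l = a * topsum x l + b * topsum z l"
    using topsum_sorts[OF s assms(5)] topsum_sorts[OF assms(1,5)] topsum_sorts[OF assms(2,5)]
    by (simp add: sum.distrib sum_distrib_left)
qed

text \<open>
  Abel summation; the induction carries the bound
  \<open>c l * (\<Sum>i\<le>l. d i) \<le> (\<Sum>i\<le>l. c i * d i)\<close>, whose left side vanishes at the end.
\<close>

lemma Abel_nonneg:
  fixes c d :: "nat \<Rightarrow> real"
  assumes c: "\<And>i. Suc i < n \<Longrightarrow> c (Suc i) \<le> c i" and d: "\<And>l. l \<le> n \<Longrightarrow> 0 \<le> (\<Sum>i<l. d i)"
    and tot: "(\<Sum>i<n. d i) = 0"
  shows "0 \<le> (\<Sum>i<n. c i * d i)"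
proof (cases n)
  case (Suc m)
  have "c l * (\<Sum>i<Suc l. d i) \<le> (\<Sum>i<Suc l. c i * d i)" if "l < n" for l
    using that
  proof (induction l)
    case (Suc l)
    have "c (Suc l) * (\<Sum>i<Suc l. d i) \<le> c l * (\<Sum>i<Suc l. d i)"
      using c[of l] d[of "Suc l"] Suc.prems by (intro mult_right_mono) auto
    also have "\<dots> \<le> (\<Sum>i<Suc l. c i * d i)" using Suc by simp
    finally show ?case by (simp add: algebra_simps)
  qed simp
  from this[of m] show ?thesis using Suc tot by simp
qed simp

text \<open>
  Rado's theorem. A hyperplane strictly separating \<open>y\<close> from the permutations of \<open>x\<close> is refuted by
  the permutation that is ordered like the normal vector: partial sums along this order are largest for
  that permutation, so Abel summation puts it on the same side as \<open>y\<close>.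
\<close>

lemma majorized_in_convex_hull_permutations:
  fixes x y :: "real^'n"
  assumes maj: "majorized y x"
  shows "y \<in> convex hull {\<chi> i. x $ p i | p. p permutes UNIV}" (is "y \<in> convex hull ?P")
proof (rule ccontr)
  assume "y \<notin> convex hull ?P"
  moreover have "finite ?P" using finite_permutations[of "UNIV :: 'n set"] by simp
  ultimately obtain a b where ab: "a \<bullet> y < b" "\<And>z. z \<in> convex hull ?P \<Longrightarrow> a \<bullet> z > b"
    using separating_hyperplane_closed_point[of "convex hull ?P" y]
    using convex_convex_hull finite_imp_compact_convex_hull compact_imp_closed by blast
  \<comment> \<open>The sign: the separating functional \<open>a\<close> is small at \<open>y\<close>, so \<open>- a\<close> is the one to maximize.\<close>
  obtain e where e: "sorts e (- a)" by (rule sorts_exists)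
  have bij: "bij_betw e {..<CARD('n)} UNIV" using e by (simp add: sorts_def)
  obtain p where p: "p permutes UNIV" "sorts e (\<chi> i. x $ p i)" using sort_along[OF bij] .
  define z where "z = (\<chi> i. x $ p i)"
  have majz: "majorized y z" unfolding z_def using majorized_permute permutes_bij[OF p(1)] maj by blast
  have re: "(\<Sum>i\<in>UNIV. g i) = (\<Sum>i<CARD('n). g (e i))" for g :: "'n \<Rightarrow> real"
    using sum.reindex_bij_betw[OF bij, of g] by simp
  have "0 \<le> (\<Sum>i<CARD('n). (- a) $ e i * (z $ e i - y $ e i))"
  proof (rule Abel_nonneg)
    show "(- a) $ e (Suc i) \<le> (- a) $ e i" if "Suc i < CARD('n)" for i
      using e that unfolding sorts_def by (meson le_SucI order_refl)
    show "0 \<le> (\<Sum>i<l. z $ e i - y $ e i)" if l: "l \<le> CARD('n)" for l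
    proof -
      have inj: "inj_on e {..<l}" using bij l by (auto simp: bij_betw_def inj_on_def)
      have "(\<Sum>i\<in>e ` {..<l}. y $ i) \<le> topsum z (card (e ` {..<l}))" using majz by (simp add: majorized_def)
      then have "(\<Sum>i<l. y $ e i) \<le> topsum z l" using inj by (simp add: card_image sum.reindex)
      then show ?thesis using topsum_sorts[OF p(2) l] by (simp add: z_def sum_subtractf)
    qed
    show "(\<Sum>i<CARD('n). z $ e i - y $ e i) = 0"
      using majz re[of "\<lambda>i. z $ i - y $ i"] by (simp add: majorized_def sum_subtractf)
  qed
  also have "\<dots> = a \<bullet> y - a \<bullet> z"
    using re[of "\<lambda>i. (- a) $ i * (z $ i - y $ i)"]
    by (simp add: inner_vec_def algebra_simps sum_subtractf)
  finally have "a \<bullet> z \<le> a \<bullet> y" by simp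
  moreover have "z \<in> convex hull ?P" using p(1) by (intro hull_inc) (auto simp: z_def)
  ultimately show False using ab by force
qed

text \<open>
  Symmetric convex functions are Schur-convex: the sublevel set of \<open>f x\<close> is convex and contains all
  permutations of \<open>x\<close>.
\<close>

lemma symmetric_convex_mono_majorized:
  fixes f :: "real^'n \<Rightarrow> real"
  assumes "convex_on UNIV f" "symmetric_function f" "majorized y x"
  shows "f y \<le> f x"
proof -
  have "convex {z. f z \<le> f x}"
  proof (rule convexI)
    fix u v :: "real^'n" and s t :: real
    assume uv: "u \<in> {z. f z \<le> f x}" "v \<in> {z. f z \<le> f x}" and st: "0 \<le> s" "0 \<le> t" "s + t = 1"
    have "f (s *\<^sub>R u + t *\<^sub>R v) \<le> s * f u + t * f v"
      using assms(1) st unfolding convex_on_def by blast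
    also have "\<dots> \<le> s * f x + t * f x" using uv st by (intro add_mono mult_left_mono) auto
    also have "\<dots> = f x" using st by (metis distrib_right mult_1)
    finally show "s *\<^sub>R u + t *\<^sub>R v \<in> {z. f z \<le> f x}" by simp
  qed
  moreover have "{\<chi> i. x $ p i | p. p permutes UNIV} \<subseteq> {z. f z \<le> f x}"
    using assms(2) by (auto simp: symmetric_function_def)
  ultimately show ?thesis
    using majorized_in_convex_hull_permutations[OF assms(3)] hull_minimal[of _ "{z. f z \<le> f x}" convex]
    by blast
qed

section \<open>Conjugation of matrices\<close>

definition diagmat :: "real^'n \<Rightarrow> real^'n^'n" where
  "diagmat y = (\<chi> i j. if i = j then y $ i else 0)"

definition conjugate :: "real^'n^'n \<Rightarrow> real^'n^'n \<Rightarrow> real^'n^'n" where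
  "conjugate Q X = Q ** X ** transpose Q"

lemma conjugate_conjugate: "conjugate P (conjugate Q X) = conjugate (P ** Q) X"
  by (simp add: conjugate_def matrix_transpose_mul matrix_mul_assoc)

lemma conjugate_mat_1 [simp]: "conjugate (mat 1) X = X"
  by (simp add: conjugate_def transpose_mat)

lemma conjugate_transpose_cancel:
  assumes "orthogonal_matrix Q"
  shows "conjugate (transpose Q) (conjugate Q X) = X" "conjugate Q (conjugate (transpose Q) X) = X"
  using assms by (simp_all add: conjugate_conjugate orthogonal_matrix_def)

lemma conjugate_entry: "conjugate Q X $ i $ j = (\<Sum>b\<in>UNIV. \<Sum>a\<in>UNIV. Q $ i $ a * X $ a $ b * Q $ j $ b)"
  by (simp add: conjugate_def matrix_matrix_mult_def transpose_def sum_distrib_right)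

lemma linear_conjugate: "linear (conjugate Q)"
  by (rule linearI)
    (simp_all add: vec_eq_iff conjugate_entry algebra_simps sum.distrib sum_distrib_left)

lemma symmetric_conjugate: "symmetric_matrix X \<Longrightarrow> symmetric_matrix (conjugate Q X)"
  by (simp add: symmetric_matrix_def conjugate_def matrix_transpose_mul matrix_mul_assoc)

lemma symmetric_diagmat: "symmetric_matrix (diagmat y)"
  by (simp add: symmetric_matrix_def diagmat_def transpose_def vec_eq_iff)

lemma trace_conjugate:
  assumes "orthogonal_matrix Q"
  shows "trace (conjugate Q X) = trace X"
  using assms
  by (metis (no_types, lifting) conjugate_def matrix_mul_assoc matrix_mul_rid orthogonal_matrix_def trace_mul_sym)

lemma inner_matrix_eq_trace: "A \<bullet> B = trace (transpose A ** B)" for A B :: "real^'n^'n"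
  unfolding inner_vec_def trace_def matrix_matrix_mult_def transpose_def
  by (simp, subst sum.swap) simp

lemma inner_conjugate: "A \<bullet> conjugate Q W = conjugate (transpose Q) A \<bullet> W"
  unfolding inner_matrix_eq_trace conjugate_def
  by (metis (no_types, lifting) matrix_mul_assoc matrix_transpose_mul trace_mul_sym transpose_transpose)

lemma conjugate_diagmat_diagonal: "conjugate Q (diagmat y) $ i $ i = (\<Sum>j\<in>UNIV. (Q $ i $ j)\<^sup>2 * y $ j)"
proof -
  have "(\<Sum>a\<in>UNIV. Q $ i $ a * diagmat y $ a $ b * Q $ i $ b) = (Q $ i $ b)\<^sup>2 * y $ b" for b
    by (simp add: diagmat_def power2_eq_square if_distrib[of "\<lambda>z. _ * z"] if_distrib[of "\<lambda>z. z * _"] cong: if_cong)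
  then show ?thesis by (simp add: conjugate_entry)
qed

lemma orthogonal_matrix_square_sums:
  fixes Q :: "real^'n^'n"
  assumes "orthogonal_matrix Q"
  shows "(\<Sum>j\<in>UNIV. (Q $ i $ j)\<^sup>2) = 1" "(\<Sum>i\<in>UNIV. (Q $ i $ j)\<^sup>2) = 1"
proof -
  have "(Q ** transpose Q) $ i $ i = 1" "(transpose Q ** Q) $ j $ j = 1"
    using assms by (simp_all add: orthogonal_matrix_def mat_def)
  then show "(\<Sum>j\<in>UNIV. (Q $ i $ j)\<^sup>2) = 1" "(\<Sum>i\<in>UNIV. (Q $ i $ j)\<^sup>2) = 1"
    by (simp_all add: matrix_matrix_mult_def transpose_def power2_eq_square)
qed

lemma symmetric_matrix_inner:
  assumes "symmetric_matrix Z"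
  shows "u \<bullet> (Z *v w) = (Z *v u) \<bullet> w"
proof -
  have "u \<bullet> (Z *v w) = (u v* Z) \<bullet> w" by (rule dot_lmul_matrix[symmetric])
  also have "u v* Z = Z *v u"
    using assms transpose_matrix_vector[of Z u] by (simp only: symmetric_matrix_def)
  finally show ?thesis .
qed

section \<open>The spectral theorem\<close>

text \<open>
  A maximizer \<open>v\<close> of the Rayleigh quotient on the unit sphere of \<open>S\<close>, with maximum \<open>c\<close>, is an
  eigenvector: \<open>N u = c u - Z u\<close> is positive semidefinite on \<open>S\<close> with \<open>v \<bullet> N v = 0\<close>, and moving
  from \<open>v\<close> in the direction \<open>N v\<close> would make the form negative unless \<open>N v = 0\<close>.
\<close>

lemma symmetric_eigenvector_in_subspace:
  fixes Z :: "real^'n^'n"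
  assumes sym: "symmetric_matrix Z" and S: "subspace S" and inv: "\<And>u. u \<in> S \<Longrightarrow> Z *v u \<in> S"
    and ne: "S \<noteq> {0}"
  obtains v c where "v \<in> S" "v \<bullet> v = 1" "Z *v v = c *\<^sub>R v"
proof -
  have scale: "(1 / norm u) *\<^sub>R u \<in> sphere 0 1 \<inter> S" if "u \<in> S" "u \<noteq> 0" for u
    using that S by (simp add: subspace_scale)
  obtain u0 where "u0 \<in> S" "u0 \<noteq> 0" using ne S subspace_0 by blast
  then have "sphere 0 1 \<inter> S \<noteq> {}" using scale by blast
  moreover have "compact (sphere 0 1 \<inter> S)" using S by (simp add: closed_subspace compact_Int_closed)
  moreover have "continuous_on (sphere 0 1 \<inter> S) (\<lambda>u. u \<bullet> (Z *v u))"
    by (intro continuous_intros linear_continuous_on matrix_vector_mul_bounded_linear)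
  ultimately obtain v where v: "v \<in> sphere 0 1 \<inter> S" and
    vmax: "\<And>u. u \<in> sphere 0 1 \<inter> S \<Longrightarrow> u \<bullet> (Z *v u) \<le> v \<bullet> (Z *v v)"
    using continuous_attains_sup[of "sphere 0 1 \<inter> S" "\<lambda>u. u \<bullet> (Z *v u)"] by blast
  define c where "c = v \<bullet> (Z *v v)"
  define N where "N = (\<lambda>u. c *\<^sub>R u - Z *v u)"
  have vv: "v \<bullet> v = 1" using v by (simp add: dot_square_norm)
  have NS: "N u \<in> S" if "u \<in> S" for u
    using that S inv by (simp add: N_def subspace_diff subspace_scale)
  have Npsd: "0 \<le> u \<bullet> N u" if "u \<in> S" for u
  proof (cases "u = 0")
    case False
    have "(1 / norm u)\<^sup>2 * (u \<bullet> (Z *v u)) \<le> c"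
      using vmax[OF scale[OF that False]]
      by (simp add: c_def power2_eq_square matrix_vector_mult_scaleR algebra_simps)
    then have "u \<bullet> (Z *v u) \<le> c * (u \<bullet> u)"
      using False by (simp add: field_simps dot_square_norm power_divide)
    then show ?thesis by (simp add: N_def inner_diff_right)
  qed (simp add: N_def)
  define w where "w = N v"
  have wS: "w \<in> S" using NS v by (simp add: w_def)
  have vN: "v \<bullet> N v = 0" using vv by (simp add: N_def inner_diff_right c_def)
  have Nsym: "u \<bullet> N u' = N u \<bullet> u'" for u u'
    using symmetric_matrix_inner[OF sym, of u u'] by (simp add: N_def inner_diff_right inner_diff_left)
  define a \<beta> where "a = w \<bullet> w" and "\<beta> = w \<bullet> N w"
  have \<beta>: "0 \<le> \<beta>" using Npsd[OF wS] by (simp add: \<beta>_def)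
  have quad: "0 \<le> 2 * t * a + t\<^sup>2 * \<beta>" for t
  proof -
    have "0 \<le> (v + t *\<^sub>R w) \<bullet> N (v + t *\<^sub>R w)"
      using S v wS by (intro Npsd) (simp add: subspace_add subspace_scale)
    also have "N (v + t *\<^sub>R w) = N v + t *\<^sub>R N w"
      by (simp add: N_def algebra_simps matrix_vector_right_distrib matrix_vector_mult_scaleR)
    also have "(v + t *\<^sub>R w) \<bullet> (N v + t *\<^sub>R N w) = v \<bullet> N v + 2 * t * a + t\<^sup>2 * \<beta>"
      using Nsym[of v w] by (simp add: inner_add_left inner_add_right a_def \<beta>_def w_def power2_eq_square algebra_simps inner_commute)
    finally show ?thesis using vN by simp
  qed
  have "a = 0"
  proof (rule ccontr)
    assume "a \<noteq> 0"
    define s where "s = a / (\<beta> + 1)"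
    have a: "a = s * (\<beta> + 1)" using \<beta> by (simp add: s_def)
    have "2 * (- s) * a + (- s)\<^sup>2 * \<beta> = - (s\<^sup>2 * (\<beta> + 2))"
      by (simp add: a algebra_simps power2_eq_square)
    moreover have "0 < s\<^sup>2 * (\<beta> + 2)" using \<beta> \<open>a \<noteq> 0\<close> a by (intro mult_pos_pos) auto
    ultimately show False using quad[of "- s"] by simp
  qed
  then have "Z *v v = c *\<^sub>R v" by (simp add: a_def w_def N_def)
  then show thesis using that v vv by blast
qed

text \<open>
  The spectral theorem relative to an invariant subspace. The relative form is needed later, for
  perturbations that act on a block of coordinates and whose eigenbasis must respect this block. The basis
  is indexed by an arbitrary set of the right cardinality, so that it can be
  combined with coordinate vectors into a matrix.
\<close>

lemma orthonormal_eigenbasis_of_subspace: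
  fixes Z :: "real^'n^'n"
  assumes sym: "symmetric_matrix Z" and "finite I"
    and "subspace S" and "\<And>u. u \<in> S \<Longrightarrow> Z *v u \<in> S" and "dim S = card I"
  shows "\<exists>v c. (\<forall>i\<in>I. v i \<in> S \<and> Z *v v i = c i *\<^sub>R v i)
     \<and> (\<forall>i\<in>I. \<forall>j\<in>I. v i \<bullet> v j = (if i = j then 1 else 0))"
  using assms(2-)
proof (induction I arbitrary: S rule: finite_induct)
  case (insert i0 I)
  have "S \<noteq> {0}" using insert by auto
  then obtain u c0 where u: "u \<in> S" "u \<bullet> u = 1" "Z *v u = c0 *\<^sub>R u"
    using symmetric_eigenvector_in_subspace[OF sym] insert by metis
  define S' where "S' = {w \<in> S. u \<bullet> w = 0}"
  have sub: "subspace S'" using insert.prems(1)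
    by (auto simp: S'_def subspace_def inner_add_right)
  have inv: "Z *v w \<in> S'" if "w \<in> S'" for w
    using that insert.prems(2) u symmetric_matrix_inner[OF sym, of u w] by (simp add: S'_def)
  have "dim {y \<in> S. \<forall>x\<in>span {u}. orthogonal x y} + dim (span {u}) = dim S"
    using insert.prems(1) u by (intro dim_subspace_orthogonal_to_vectors) (auto simp: span_minimal)
  moreover have "{y \<in> S. \<forall>x\<in>span {u}. orthogonal x y} = S'"
    by (auto simp: S'_def orthogonal_def span_singleton)
  moreover have "u \<noteq> 0" using u by auto
  then have "dim (span {u}) = 1" by (simp add: dim_span)
  ultimately have "dim S' = card I" using insert by simp
  from insert.IH[OF sub inv this] obtain v c where
    v: "\<forall>i\<in>I. v i \<in> S' \<and> Z *v v i = c i *\<^sub>R v i"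
       "\<forall>i\<in>I. \<forall>j\<in>I. v i \<bullet> v j = (if i = j then 1 else 0)" by blast
  show ?case
    by (rule exI[of _ "v(i0 := u)"], rule exI[of _ "c(i0 := c0)"])
      (use v u insert.hyps in \<open>auto simp: S'_def inner_commute\<close>)
qed simp

lemma orthonormal_eigenbasis_decomposition:
  fixes Z :: "real^'n^'n"
  assumes eig: "\<And>i. Z *v v i = c i *\<^sub>R v i"
    and on: "\<And>i j. v i \<bullet> v j = (if i = j then 1 else 0)"
  defines "V \<equiv> \<chi> a i. v i $ a"
  shows "orthogonal_matrix V" "Z = conjugate V (diagmat (\<chi> i. c i))"
proof -
  show V: "orthogonal_matrix V"
    unfolding orthogonal_matrix using on
    by (simp add: vec_eq_iff V_def matrix_matrix_mult_def transpose_def mat_def inner_vec_def)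
  have "Z ** V = V ** diagmat (\<chi> i. c i)"
  proof -
    have "(Z ** V) $ a $ i = (V ** diagmat (\<chi> i. c i)) $ a $ i" for a i
    proof -
      have "(Z ** V) $ a $ i = (Z *v v i) $ a"
        by (simp add: V_def matrix_matrix_mult_def matrix_vector_mult_def)
      also have "\<dots> = c i * v i $ a" by (simp add: eig)
      also have "\<dots> = (V ** diagmat (\<chi> i. c i)) $ a $ i"
        by (simp add: V_def matrix_matrix_mult_def diagmat_def if_distrib[of "\<lambda>z. _ * z"] cong: if_cong)
      finally show ?thesis .
    qed
    then show ?thesis by (simp add: vec_eq_iff)
  qed
  then show "Z = conjugate V (diagmat (\<chi> i. c i))"
    using V unfolding conjugate_def by (metis matrix_mul_assoc matrix_mul_rid orthogonal_matrix_def)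
qed

lemma spectral_decomposition:
  fixes X :: "real^'n^'n"
  assumes "symmetric_matrix X"
  obtains Q y where "orthogonal_matrix Q" "X = conjugate Q (diagmat y)"
proof -
  obtain v c where "\<forall>i\<in>UNIV. v i \<in> (UNIV :: (real^'n) set) \<and> X *v v i = c i *\<^sub>R v i"
     "\<forall>i\<in>UNIV. \<forall>j\<in>UNIV. v (i :: 'n) \<bullet> v j = (if i = j then 1 else 0)"
    using orthonormal_eigenbasis_of_subspace[OF assms, of "UNIV :: 'n set" UNIV] by auto
  then show thesis
    using orthonormal_eigenbasis_decomposition[of X v c] that by auto
qed

section \<open>Rank and eigenvalues of a conjugated diagonal matrix\<close>

lemma rank_conjugate:
  assumes "orthogonal_matrix Q"
  shows "rank (conjugate Q X) = rank X"
proof -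
  have le: "rank (conjugate P Y) \<le> rank Y" for P Y :: "real^'n^'n"
    unfolding conjugate_def by (meson order_trans rank_mul_le_left rank_mul_le_right)
  show ?thesis using le[of Q X] le[of "transpose Q" "conjugate Q X"] conjugate_transpose_cancel[OF assms] by simp
qed

lemma diagmat_mult_vec: "(diagmat y *v x) $ i = y $ i * x $ i"
  by (simp add: diagmat_def matrix_vector_mult_def if_distrib[of "\<lambda>z. z * _"] cong: if_cong)

lemma dim_coordinate_subspace: "dim {x :: real^'n. \<forall>i. i \<notin> d \<longrightarrow> x $ i = 0} = card d"
  using dim_substandard_cart[where 'a = real, of d] by (simp add: dim_vec_eq)

lemma rank_diagmat: "rank (diagmat y) = card {i. y $ i \<noteq> 0}"
proof -
  have "range ((*v) (diagmat y)) = {x. \<forall>i. i \<notin> {i. y $ i \<noteq> 0} \<longrightarrow> x $ i = 0}" (is "?L = ?R")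
  proof
    show "?L \<subseteq> ?R" by (auto simp: diagmat_mult_vec)
    show "?R \<subseteq> ?L"
    proof
      fix x assume "x \<in> ?R"
      then have "x = diagmat y *v (\<chi> i. x $ i / y $ i)"
        by (auto simp: vec_eq_iff diagmat_mult_vec)
      then show "x \<in> ?L" by blast
    qed
  qed
  then show ?thesis by (simp only: rank_dim_range dim_coordinate_subspace)
qed

text \<open>
  The characteristic polynomial of the conjugated diagonal matrix splits with roots \<open>y\<close>, so the
  vector chosen by \<^const>\<open>eigenvalue_vector\<close> has the same multiset of entries.
\<close>

lemma eigenvalue_vector_conjugate_diagmat:
  fixes y :: "real^'n"
  assumes Q: "orthogonal_matrix Q"
  obtains p where "p permutes UNIV" "eigenvalue_vector (conjugate Q (diagmat y)) = (\<chi> i. y $ p i)"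
proof -
  define l where "l = eigenvalue_vector (conjugate Q (diagmat y))"
  have "det (mat t - conjugate Q (diagmat y)) = (\<Prod>i\<in>UNIV. t - y $ i)" for t
  proof -
    have "mat t = conjugate Q (mat t)"
    proof -
      have "(mat t :: real^'n^'n) = t *\<^sub>R mat 1" by (simp add: vec_eq_iff mat_def)
      then show ?thesis
        using Q linear_scale[OF linear_conjugate, of Q t "mat 1"]
        by (simp add: conjugate_def orthogonal_matrix_def)
    qed
    then have "mat t - conjugate Q (diagmat y) = conjugate Q (mat t - diagmat y)"
      by (metis linear_conjugate linear_diff)
    also have "mat t - diagmat y = diagmat (\<chi> i. t - y $ i)"
      by (simp add: vec_eq_iff mat_def diagmat_def)
    also have "det (conjugate Q \<dots>) = (det Q * det (transpose Q)) * det (diagmat (\<chi> i. t - y $ i))"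
      by (simp add: conjugate_def det_mul)
    also have "det Q * det (transpose Q) = 1"
      using Q by (metis det_I det_mul orthogonal_matrix_def)
    also have "det (diagmat (\<chi> i. t - y $ i)) = (\<Prod>i\<in>UNIV. t - y $ i)"
      by (subst det_diagonal) (simp_all add: diagmat_def)
    finally show ?thesis by simp
  qed
  then have "\<forall>t. det (mat t - conjugate Q (diagmat y)) = (\<Prod>i\<in>UNIV. t - l $ i)"
    unfolding l_def eigenvalue_vector_def by (rule_tac someI_ex) blast
  then have prods: "(\<Prod>i\<in>UNIV. t - y $ i) = (\<Prod>i\<in>UNIV. t - l $ i)" for t
    using \<open>\<And>t. det (mat t - conjugate Q (diagmat y)) = (\<Prod>i\<in>UNIV. t - y $ i)\<close> by simp
  define P where "P = (\<lambda>z :: real^'n. \<Prod>i\<in>UNIV. [:- (z $ i), 1:])"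
  have "poly (P y) = poly (P l)"
    using prods by (simp add: fun_eq_iff P_def poly_prod)
  then have "P y = P l" by (simp add: poly_eq_poly_eq_iff)
  moreover have "proots (P z) = image_mset (\<lambda>i. z $ i) (mset_set UNIV)" for z :: "real^'n"
    unfolding P_def by (subst proots_prod) (simp_all add: sum_unfold_sum_mset)
  ultimately have "image_mset (\<lambda>i. l $ i) (mset_set UNIV) = image_mset (\<lambda>i. y $ i) (mset_set UNIV)"
    by metis
  then obtain p where "p permutes UNIV" "\<forall>i\<in>UNIV. l $ i = y $ p i"
    by (rule image_mset_eq_implies_permutes[OF finite])
  then show thesis by (intro that[of p]) (simp_all add: l_def[symmetric] vec_eq_iff)
qed

lemma symmetric_function_eigenvalue_vector:
  assumes "symmetric_function f" "orthogonal_matrix Q"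
  shows "f (eigenvalue_vector (conjugate Q (diagmat y))) = f y"
  using eigenvalue_vector_conjugate_diagmat[OF assms(2), of y] assms(1)
  by (metis symmetric_function_def)

section \<open>Orbit hulls of diagonal matrices\<close>

text \<open>
  Schur's theorem. A partial sum of the diagonal is a weighted sum of the eigenvalues; since the
  squared entries of an orthogonal matrix form a doubly stochastic matrix, the weights are those of a
  fractional knapsack.
\<close>

lemma Schur_diagonal_majorized:
  fixes Q :: "real^'n^'n"
  assumes Q: "orthogonal_matrix Q"
  shows "majorized (\<chi> i. conjugate Q (diagmat y) $ i $ i) y"
  unfolding majorized_def
proof (intro conjI allI)
  have "(\<Sum>i\<in>UNIV. conjugate Q (diagmat y) $ i $ i) = trace (diagmat y)"
    using trace_conjugate[OF Q, of "diagmat y"] by (simp add: trace_def)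
  then show "(\<Sum>i\<in>UNIV. (\<chi> i. conjugate Q (diagmat y) $ i $ i) $ i) = (\<Sum>i\<in>UNIV. y $ i)"
    by (simp add: trace_def diagmat_def)
  fix S :: "'n set"
  define w where "w = (\<lambda>j. \<Sum>i\<in>S. (Q $ i $ j)\<^sup>2)"
  have "(\<Sum>i\<in>S. conjugate Q (diagmat y) $ i $ i) = (\<Sum>j\<in>UNIV. w j * y $ j)"
    unfolding conjugate_diagmat_diagonal w_def sum_distrib_right by (rule sum.swap)
  moreover have "\<exists>T\<subseteq>UNIV. card T = card S \<and> (\<Sum>j\<in>UNIV. w j * y $ j) \<le> (\<Sum>j\<in>T. y $ j)"
  proof (rule fractional_knapsack_ex)
    show "0 \<le> w j \<and> w j \<le> 1" for j
    proof -
      have "w j \<le> (\<Sum>i\<in>UNIV. (Q $ i $ j)\<^sup>2)" unfolding w_def by (intro sum_mono2) auto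
      then show ?thesis
        using orthogonal_matrix_square_sums(2)[OF Q] by (simp add: w_def sum_nonneg)
    qed
    show "sum w UNIV = real (card S)"
      unfolding w_def using orthogonal_matrix_square_sums(1)[OF Q] by (subst sum.swap) simp
  qed simp
  ultimately show "(\<Sum>i\<in>S. (\<chi> i. conjugate Q (diagmat y) $ i $ i) $ i) \<le> topsum y (card S)"
    using sum_le_topsum[of y] by (simp) (metis order_trans)
qed

text \<open>
  The convex hull of the orbit of \<open>diagmat x\<close> under orthogonal conjugation, written as an
  intersection of half-spaces by Ky Fan's maximum principle. Convexity and closedness are immediate in
  this form, and membership amounts to majorization of the eigenvalues by \<open>x\<close>.
\<close>

definition Ky_Fan_body :: "real^'n \<Rightarrow> (real^'n^'n) set" where
  "Ky_Fan_body x =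
     {X. symmetric_matrix X \<and> (\<forall>Q. orthogonal_matrix Q \<longrightarrow> majorized (\<chi> i. conjugate Q X $ i $ i) x)}"

lemma conjugate_diagmat_in_Ky_Fan_body:
  assumes "orthogonal_matrix P" "majorized y x"
  shows "conjugate P (diagmat y) \<in> Ky_Fan_body x"
  unfolding Ky_Fan_body_def
proof (intro CollectI conjI allI impI)
  show "symmetric_matrix (conjugate P (diagmat y))" by (intro symmetric_conjugate symmetric_diagmat)
  fix Q :: "real^'a^'a" assume "orthogonal_matrix Q"
  then show "majorized (\<chi> i. conjugate Q (conjugate P (diagmat y)) $ i $ i) x"
    using Schur_diagonal_majorized[of "Q ** P" y] assms orthogonal_matrix_mul[of Q P]
    by (simp add: conjugate_conjugate majorized_trans)
qed

lemma Ky_Fan_body_spectral: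
  assumes "X \<in> Ky_Fan_body x"
  obtains Q y where "orthogonal_matrix Q" "X = conjugate Q (diagmat y)" "majorized y x"
proof -
  obtain Q y where Q: "orthogonal_matrix Q" "X = conjugate Q (diagmat y)"
    using assms spectral_decomposition[of X] by (auto simp: Ky_Fan_body_def)
  have "majorized (\<chi> i. conjugate (transpose Q) X $ i $ i) x"
    using assms Q(1) by (simp add: Ky_Fan_body_def)
  moreover have "(\<chi> i. conjugate (transpose Q) X $ i $ i) = y"
    using Q by (simp add: conjugate_transpose_cancel diagmat_def)
  ultimately show thesis using that Q by metis
qed

lemma conjugate_in_Ky_Fan_body:
  assumes "orthogonal_matrix P" "X \<in> Ky_Fan_body x"
  shows "conjugate P X \<in> Ky_Fan_body x"
proof -
  obtain Q y where "orthogonal_matrix Q" "X = conjugate Q (diagmat y)" "majorized y x"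
    using assms(2) by (rule Ky_Fan_body_spectral)
  then show ?thesis
    using conjugate_diagmat_in_Ky_Fan_body[of "P ** Q" y x] assms(1)
    by (simp add: conjugate_conjugate orthogonal_matrix_mul)
qed

lemma symmetric_matrix_combination:
  "symmetric_matrix X \<Longrightarrow> symmetric_matrix Z \<Longrightarrow> symmetric_matrix (a *\<^sub>R X + b *\<^sub>R Z)"
  by (simp add: symmetric_matrix_def transpose_def vec_eq_iff)

text \<open>
  The right-hand sides of the defining inequalities are additive for comonotone \<open>x\<close> and \<open>z\<close>.
\<close>

lemma Ky_Fan_body_combination:
  fixes x z :: "real^'n"
  assumes X: "X \<in> Ky_Fan_body x" and Z: "Z \<in> Ky_Fan_body z" and s: "sorts e x" "sorts e z"
    and ab: "0 \<le> a" "0 \<le> b"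
  shows "a *\<^sub>R X + b *\<^sub>R Z \<in> Ky_Fan_body (a *\<^sub>R x + b *\<^sub>R z)"
  unfolding Ky_Fan_body_def
proof (intro CollectI conjI allI impI)
  show "symmetric_matrix (a *\<^sub>R X + b *\<^sub>R Z)"
    using X Z by (simp add: Ky_Fan_body_def symmetric_matrix_combination)
  fix Q :: "real^'n^'n" assume Q: "orthogonal_matrix Q"
  define u v where "u = (\<chi> i. conjugate Q X $ i $ i)" and "v = (\<chi> i. conjugate Q Z $ i $ i)"
  have uv: "majorized u x" "majorized v z" using X Z Q by (simp_all add: Ky_Fan_body_def u_def v_def)
  have "(\<chi> i. conjugate Q (a *\<^sub>R X + b *\<^sub>R Z) $ i $ i) = a *\<^sub>R u + b *\<^sub>R v"
    by (simp add: vec_eq_iff u_def v_def linear_add[OF linear_conjugate] linear_scale[OF linear_conjugate])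
  moreover have "majorized (a *\<^sub>R u + b *\<^sub>R v) (a *\<^sub>R x + b *\<^sub>R z)"
    unfolding majorized_def
  proof (intro conjI allI)
    show "(\<Sum>i\<in>UNIV. (a *\<^sub>R u + b *\<^sub>R v) $ i) = (\<Sum>i\<in>UNIV. (a *\<^sub>R x + b *\<^sub>R z) $ i)"
      using uv by (simp add: majorized_def sum.distrib flip: sum_distrib_left)
    fix S :: "'n set"
    have "(\<Sum>i\<in>S. (a *\<^sub>R u + b *\<^sub>R v) $ i) = a * (\<Sum>i\<in>S. u $ i) + b * (\<Sum>i\<in>S. v $ i)"
      by (simp add: sum.distrib sum_distrib_left)
    also have "\<dots> \<le> a * topsum x (card S) + b * topsum z (card S)"
      using uv ab by (intro add_mono mult_left_mono) (auto simp: majorized_def)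
    also have "\<dots> = topsum (a *\<^sub>R x + b *\<^sub>R z) (card S)"
      using topsum_add_comonotone[OF s ab, of "card S"] by (simp add: card_mono)
    finally show "(\<Sum>i\<in>S. (a *\<^sub>R u + b *\<^sub>R v) $ i) \<le> topsum (a *\<^sub>R x + b *\<^sub>R z) (card S)" .
  qed
  ultimately show "majorized (\<chi> i. conjugate Q (a *\<^sub>R X + b *\<^sub>R Z) $ i $ i) (a *\<^sub>R x + b *\<^sub>R z)" by simp
qed

lemma convex_Ky_Fan_body: "convex (Ky_Fan_body x)"
proof (rule convexI)
  fix X Z :: "real^'a^'a" and a b :: real
  assume *: "X \<in> Ky_Fan_body x" "Z \<in> Ky_Fan_body x" "0 \<le> a" "0 \<le> b" "a + b = 1"
  obtain e where "sorts e x" by (rule sorts_exists)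
  then have "a *\<^sub>R X + b *\<^sub>R Z \<in> Ky_Fan_body (a *\<^sub>R x + b *\<^sub>R x)"
    using * by (intro Ky_Fan_body_combination)
  then show "a *\<^sub>R X + b *\<^sub>R Z \<in> Ky_Fan_body x"
    using *(5) by (metis scaleR_add_left scaleR_one)
qed

lemma norm_permute: "p permutes UNIV \<Longrightarrow> norm (\<chi> i. x $ p i) = norm (x :: real^'n)"
  using sum.reindex_bij_betw[OF permutes_bij, of p UNIV "\<lambda>i. (x $ i)\<^sup>2"]
  by (simp add: norm_vec_def L2_set_def)

lemma norm_conjugate:
  assumes "orthogonal_matrix Q"
  shows "norm (conjugate Q X) = norm X"
  using assms by (simp add: norm_eq_sqrt_inner inner_conjugate conjugate_transpose_cancel)

lemma norm_diagmat: "norm (diagmat y) = norm y"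
proof -
  have "norm (diagmat y $ i) = \<bar>y $ i\<bar>" for i
    by (simp add: norm_vec_def L2_set_def diagmat_def if_distrib[of "\<lambda>z. z\<^sup>2"] cong: if_cong)
  then show ?thesis by (simp add: norm_vec_def[of "diagmat y"]  norm_vec_def[of y])
qed

text \<open>
  Bounded because the Frobenius norm of a matrix is the norm of its eigenvalue vector, and the norm is
  Schur-convex.
\<close>

lemma compact_Ky_Fan_body:
  fixes x :: "real^'n"
  shows "compact (Ky_Fan_body x)"
  unfolding compact_eq_bounded_closed
proof
  show "bounded (Ky_Fan_body x)"
  proof (rule boundedI)
    fix X assume "X \<in> Ky_Fan_body x"
    then obtain Q y where Qy: "orthogonal_matrix Q" "X = conjugate Q (diagmat y)" "majorized y x"
      by (rule Ky_Fan_body_spectral)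
    have "convex_on UNIV (norm :: real^'n \<Rightarrow> real)"
      using convex_on_dist[of "UNIV :: (real^'n) set" 0] by simp
    moreover have "symmetric_function (norm :: real^'n \<Rightarrow> real)"
      by (simp add: symmetric_function_def norm_permute)
    ultimately have "norm y \<le> norm x"
      using symmetric_convex_mono_majorized[OF _ _ Qy(3)] by blast
    then show "norm X \<le> norm x" using Qy by (simp add: norm_conjugate norm_diagmat)
  qed
  have cont: "continuous_on UNIV (\<lambda>X. \<Sum>i\<in>S. conjugate Q X $ i $ i)" for Q and S :: "'n set"
    by (intro continuous_intros linear_continuous_on linear_conjugate linear_conv_bounded_linear[THEN iffD1])
  have "Ky_Fan_body x = {X. transpose X = X} \<inter> (\<Inter>Q\<in>Collect orthogonal_matrix.
      {X. (\<Sum>i\<in>UNIV. conjugate Q X $ i $ i) = (\<Sum>i\<in>UNIV. x $ i)} \<inter>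
      (\<Inter>S. {X. (\<Sum>i\<in>S. conjugate Q X $ i $ i) \<le> topsum x (card S)}))"
    by (auto simp: Ky_Fan_body_def majorized_def symmetric_matrix_def)
  moreover have "continuous_on UNIV (transpose :: real^'n^'n \<Rightarrow> real^'n^'n)"
  proof (intro linear_continuous_on linear_conv_bounded_linear[THEN iffD1])
    show "linear (transpose :: real^'n^'n \<Rightarrow> real^'n^'n)"
      by (rule linearI) (simp_all add: transpose_def vec_eq_iff)
  qed
  ultimately show "closed (Ky_Fan_body x)"
    by (simp only:)
      (intro closed_Int closed_INT ballI closed_Collect_eq closed_Collect_le cont continuous_intros)
qed

section \<open>The convex hull of the spectral domain\<close>

text \<open>
  For symmetric \<open>f\<close> these are, in any order, the eigenvalues of the members of \<open>spectral_domain f r\<close>.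
\<close>

definition sparse_feasible_vectors :: "(real^'n \<Rightarrow> real) \<Rightarrow> nat \<Rightarrow> (real^'n) set" where
  "sparse_feasible_vectors f r = {x. (\<forall>i. 0 \<le> x $ i) \<and> card {i. x $ i \<noteq> 0} \<le> r \<and> f x \<le> 0}"

lemma psd_cone_conjugate:
  assumes "X \<in> psd_cone"
  shows "conjugate Q X \<in> psd_cone"
proof -
  have "v \<bullet> (conjugate Q X *v v) = (transpose Q *v v) \<bullet> (X *v (transpose Q *v v))" for v
    unfolding conjugate_def
    by (metis dot_lmul_matrix matrix_vector_mul_assoc transpose_matrix_vector)
  then show ?thesis using assms by (simp add: psd_cone_def symmetric_conjugate)
qed

lemma diagmat_psd_iff: "diagmat y \<in> psd_cone \<longleftrightarrow> (\<forall>i. 0 \<le> y $ i)"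
proof
  assume psd: "diagmat y \<in> psd_cone"
  show "\<forall>i. 0 \<le> y $ i"
  proof
    fix i
    have "axis i 1 \<bullet> (diagmat y *v axis i 1) = y $ i"
      by (simp add: inner_axis' diagmat_mult_vec)
    then show "0 \<le> y $ i" using psd unfolding psd_cone_def by (metis (mono_tags, lifting) mem_Collect_eq)
  qed
next
  assume "\<forall>i. 0 \<le> y $ i"
  then have "0 \<le> v \<bullet> (diagmat y *v v)" for v
    by (auto simp: inner_vec_def diagmat_mult_vec mult.left_commute[of "v $ _"] intro!: sum_nonneg)
  then show "diagmat y \<in> psd_cone" by (simp add: psd_cone_def symmetric_diagmat)
qed

lemma conjugate_diagmat_in_spectral_domain_iff:
  assumes f: "symmetric_function f" and Q: "orthogonal_matrix Q"
  shows "conjugate Q (diagmat x) \<in> spectral_domain f r \<longleftrightarrow> x \<in> sparse_feasible_vectors f r"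
proof -
  have "conjugate Q (diagmat x) \<in> psd_cone \<longleftrightarrow> diagmat x \<in> psd_cone"
    using psd_cone_conjugate[of "diagmat x" Q] psd_cone_conjugate[of "conjugate Q (diagmat x)" "transpose Q"]
      conjugate_transpose_cancel[OF Q] by auto
  then show ?thesis
    by (simp add: spectral_domain_def sparse_feasible_vectors_def diagmat_psd_iff rank_conjugate[OF Q] rank_diagmat
        symmetric_function_eigenvalue_vector[OF f Q])
qed

lemma sparse_feasible_vectors_permute:
  assumes f: "symmetric_function f" and p: "p permutes UNIV" and x: "x \<in> sparse_feasible_vectors f r"
  shows "(\<chi> i. x $ p i) \<in> sparse_feasible_vectors f r"
proof -
  have "p ` {i. x $ p i \<noteq> 0} = {i. x $ i \<noteq> 0}"
    using permutes_surj[OF p] by (auto simp: surj_def)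
  then have "card {i. x $ p i \<noteq> 0} = card {i. x $ i \<noteq> 0}"
    by (metis card_image permutes_inj_on[OF p])
  then show ?thesis using x f p by (auto simp: sparse_feasible_vectors_def symmetric_function_def)
qed

text \<open>
  By Rado's theorem the eigenvalues are a convex combination of permutations of \<open>x\<close>; keeping the
  eigenbasis fixed, the matrix is the same combination of matrices with spectrum \<open>x\<close>.
\<close>

lemma Ky_Fan_body_subset_hull:
  assumes f: "symmetric_function f" and x: "x \<in> sparse_feasible_vectors f r"
  shows "Ky_Fan_body x \<subseteq> convex hull (spectral_domain f r)"
proof
  fix X assume "X \<in> Ky_Fan_body x"
  then obtain Q y where Q: "orthogonal_matrix Q" "X = conjugate Q (diagmat y)" "majorized y x"
    by (rule Ky_Fan_body_spectral)
  have lin: "linear (\<lambda>z. conjugate Q (diagmat z))"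
    by (rule linear_compose[OF _ linear_conjugate, unfolded o_def])
      (auto intro!: linearI simp: diagmat_def vec_eq_iff)
  let ?P = "{\<chi> i. x $ p i | p. p permutes UNIV}"
  have "X \<in> (\<lambda>z. conjugate Q (diagmat z)) ` (convex hull ?P)"
    using majorized_in_convex_hull_permutations[OF Q(3)] Q(2) by blast
  also have "\<dots> = convex hull ((\<lambda>z. conjugate Q (diagmat z)) ` ?P)"
    by (rule convex_hull_linear_image[OF lin])
  also have "\<dots> \<subseteq> convex hull (spectral_domain f r)"
    using sparse_feasible_vectors_permute[OF f _ x]
    by (intro hull_mono) (auto simp: conjugate_diagmat_in_spectral_domain_iff[OF f Q(1)])
  finally show "X \<in> convex hull (spectral_domain f r)" .
qed

text \<open>
  Passing to the convex hull destroys only the rank constraint: nonnegativity and \<open>f \<le> 0\<close> are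
  inherited through majorization.
\<close>

lemma low_rank_in_Ky_Fan_body:
  assumes f: "convex_on UNIV f" "symmetric_function f" and x: "x \<in> sparse_feasible_vectors f r"
    and X: "X \<in> Ky_Fan_body x" and rk: "rank X \<le> k"
  shows "X \<in> spectral_domain f k"
proof -
  obtain Q y where Q: "orthogonal_matrix Q" "X = conjugate Q (diagmat y)" "majorized y x"
    using X by (rule Ky_Fan_body_spectral)
  have "f y \<le> 0"
    using symmetric_convex_mono_majorized[OF f Q(3)] x by (simp add: sparse_feasible_vectors_def)
  moreover have "0 \<le> y $ i" for i
    using majorized_nonneg[OF Q(3)] x by (simp add: sparse_feasible_vectors_def)
  moreover have "card {i. y $ i \<noteq> 0} \<le> k" using rk Q by (simp add: rank_conjugate rank_diagmat)
  ultimately have "y \<in> sparse_feasible_vectors f k" by (simp add: sparse_feasible_vectors_def)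
  then show ?thesis using conjugate_diagmat_in_spectral_domain_iff[OF f(2) Q(1)] Q(2) by simp
qed

text \<open>
  Nonnegative vectors sorted by the same enumeration have nested supports, so a combination is as
  sparse as one of them.
\<close>

lemma sparse_feasible_vectors_combination:
  fixes x z :: "real^'n"
  assumes f: "convex_on UNIV f" and x: "x \<in> sparse_feasible_vectors f r" and z: "z \<in> sparse_feasible_vectors f r"
    and s: "sorts e x" "sorts e z" and ab: "0 \<le> a" "0 \<le> b" "a + b = 1"
  shows "a *\<^sub>R x + b *\<^sub>R z \<in> sparse_feasible_vectors f r"
proof -
  let ?supp = "\<lambda>x :: real^'n. {i. x $ i \<noteq> 0}"
  have nn: "0 \<le> x $ i" "0 \<le> z $ i" for i using x z by (auto simp: sparse_feasible_vectors_def)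
  have "?supp x \<subseteq> ?supp z \<or> ?supp z \<subseteq> ?supp x"
  proof (rule ccontr)
    assume "\<not> ?thesis"
    then obtain i j where ij: "x $ i \<noteq> 0" "z $ i = 0" "z $ j \<noteq> 0" "x $ j = 0" by blast
    have enum: "\<exists>a<CARD('n). i = e a" for i
      using s(1) unfolding sorts_def bij_betw_def by (metis UNIV_I imageE lessThan_iff)
    obtain a b where ab: "a < CARD('n)" "i = e a" "b < CARD('n)" "j = e b" using enum by metis
    consider "a \<le> b" | "b \<le> a" by linarith
    then show False
    proof cases
      case 1
      then have "z $ j \<le> z $ i" using s(2) ab by (simp add: sorts_def)
      then show ?thesis using ij nn[of j] by simp
    next
      case 2
      then have "x $ i \<le> x $ j" using s(1) ab by (simp add: sorts_def)
      then show ?thesis using ij nn[of i] by simp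
    qed
  qed
  moreover have "?supp (a *\<^sub>R x + b *\<^sub>R z) \<subseteq> ?supp x \<union> ?supp z" by auto
  ultimately have "?supp (a *\<^sub>R x + b *\<^sub>R z) \<subseteq> ?supp x \<or> ?supp (a *\<^sub>R x + b *\<^sub>R z) \<subseteq> ?supp z" by blast
  then have "card (?supp (a *\<^sub>R x + b *\<^sub>R z)) \<le> r"
    using x z unfolding sparse_feasible_vectors_def
    by (metis (mono_tags, lifting) card_mono finite mem_Collect_eq order_trans)
  moreover have "f (a *\<^sub>R x + b *\<^sub>R z) \<le> 0"
  proof -
    have "f (a *\<^sub>R x + b *\<^sub>R z) \<le> a * f x + b * f z"
      using f ab unfolding convex_on_def by blast
    also have "\<dots> \<le> 0" using x z ab
      by (intro add_nonpos_nonpos mult_nonneg_nonpos) (auto simp: sparse_feasible_vectors_def)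
    finally show ?thesis .
  qed
  ultimately show ?thesis using nn ab by (simp add: sparse_feasible_vectors_def)
qed

text \<open>
  The union of the bodies is convex because, after permuting one of the two vectors, any two of them may
  be assumed to be sorted by the same enumeration. Together with the previous inclusion this describes
  the convex hull of the spectral domain as a union of compact convex orbit hulls.
\<close>

lemma hull_subset_Ky_Fan_bodies:
  assumes f: "convex_on UNIV f" "symmetric_function f"
  shows "convex hull (spectral_domain f r) \<subseteq> (\<Union>x\<in>sparse_feasible_vectors f r. Ky_Fan_body x)" (is "_ \<subseteq> ?U")
proof (rule hull_minimal)
  show "spectral_domain f r \<subseteq> ?U"
  proof
    fix X assume X: "X \<in> spectral_domain f r"
    then obtain Q y where Q: "orthogonal_matrix Q" "X = conjugate Q (diagmat y)"
      using spectral_decomposition[of X] by (auto simp: spectral_domain_def psd_cone_def)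
    have "y \<in> sparse_feasible_vectors f r"
      using X conjugate_diagmat_in_spectral_domain_iff[OF f(2) Q(1)] Q(2) by simp
    moreover have "majorized y y" by (simp add: majorized_def sum_le_topsum)
    ultimately show "X \<in> ?U" using conjugate_diagmat_in_Ky_Fan_body[OF Q(1)] Q(2) by blast
  qed
  show "convex ?U"
  proof (rule convexI)
    fix X Z :: "real^'a^'a" and a b :: real
    assume "X \<in> ?U" "Z \<in> ?U" and ab: "0 \<le> a" "0 \<le> b" "a + b = 1"
    then obtain x z where x: "x \<in> sparse_feasible_vectors f r" "X \<in> Ky_Fan_body x"
      and z: "z \<in> sparse_feasible_vectors f r" "Z \<in> Ky_Fan_body z" by blast
    obtain e where e: "sorts e x" by (rule sorts_exists)
    then have "bij_betw e {..<CARD('a)} UNIV" by (simp add: sorts_def)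
    then obtain p where p: "p permutes UNIV" "sorts e (\<chi> i. z $ p i)" by (rule sort_along)
    define z' where "z' = (\<chi> i. z $ p i)"
    have z': "z' \<in> sparse_feasible_vectors f r" "Z \<in> Ky_Fan_body z'"
      using sparse_feasible_vectors_permute[OF f(2) p(1) z(1)] z(2) majorized_permute[OF permutes_bij[OF p(1)]]
      by (simp_all add: z'_def Ky_Fan_body_def)
    have "sorts e z'" using p by (simp add: z'_def)
    then have "a *\<^sub>R x + b *\<^sub>R z' \<in> sparse_feasible_vectors f r"
        "a *\<^sub>R X + b *\<^sub>R Z \<in> Ky_Fan_body (a *\<^sub>R x + b *\<^sub>R z')"
      using sparse_feasible_vectors_combination[OF f(1) x(1) z'(1) e _ ab]
        Ky_Fan_body_combination[OF x(2) z'(2) e _ ab(1,2)] by blast+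
    then show "a *\<^sub>R X + b *\<^sub>R Z \<in> ?U" by blast
  qed
qed

section \<open>Directions in which a matrix of high rank can move\<close>

text \<open>
  The perturbed matrix has an eigenbasis consisting of coordinate vectors outside \<open>B\<close> and of an
  orthonormal basis of the coordinate subspace of \<open>B\<close>. Partial sums of eigenvalues over sets disjoint
  from \<open>B\<close> are unchanged, and so are those over sets containing \<open>B\<close>, as \<open>W\<close> has trace 0. For the
  remaining sets the eigenvalue sums move by at most a multiple of \<open>\<bar>t\<bar>\<close> beyond some partial sum of
  \<open>y\<close> over a set that cuts \<open>B\<close>, and the finitely many sums of this kind leave a uniform gap.
\<close>

lemma block_perturbation_in_Ky_Fan_body:
  fixes x y :: "real^'n" and W :: "real^'n^'n"
  assumes maj: "majorized y x"
    and slack: "\<And>S. S \<inter> B \<noteq> {} \<Longrightarrow> \<not> B \<subseteq> S \<Longrightarrow> (\<Sum>i\<in>S. y $ i) < topsum x (card S)"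
    and W: "symmetric_matrix W" "\<And>i j. i \<notin> B \<Longrightarrow> W $ i $ j = 0" "trace W = 0"
  obtains \<delta> where "0 < \<delta>" "\<And>t. \<bar>t\<bar> \<le> \<delta> \<Longrightarrow> diagmat y + t *\<^sub>R W \<in> Ky_Fan_body x"
proof -
  define gaps where "gaps = (\<lambda>S. topsum x (card S) - (\<Sum>i\<in>S. y $ i)) ` {S. S \<inter> B \<noteq> {} \<and> \<not> B \<subseteq> S}"
  define \<epsilon> where "\<epsilon> = Min (insert 1 gaps)"
  have fin: "finite gaps" by (simp add: gaps_def)
  then have "0 < \<epsilon>" using slack by (auto simp: \<epsilon>_def gaps_def)
  have gap: "(\<Sum>i\<in>S. y $ i) + \<epsilon> \<le> topsum x (card S)" if "S \<inter> B \<noteq> {}" "\<not> B \<subseteq> S" for S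
  proof -
    have "\<epsilon> \<le> topsum x (card S) - (\<Sum>i\<in>S. y $ i)"
      unfolding \<epsilon>_def by (rule Min_le) (use fin that in \<open>auto simp: gaps_def\<close>)
    then show ?thesis by simp
  qed
  obtain K where K: "0 < K" "\<And>v. norm (W *v v) \<le> norm v * K"
    using bounded_linear.pos_bounded[OF matrix_vector_mul_bounded_linear[of W]] by blast
  \<comment> \<open>A partial sum has at most \<open>CARD('n)\<close> eigenvalues, and \<open>t *\<^sub>R W\<close> contributes at most \<open>\<delta> * K\<close> to each.\<close>
  define \<delta> where "\<delta> = \<epsilon> / (K * CARD('n))"
  have "0 < \<delta>" using \<open>0 < \<epsilon>\<close> K by (simp add: \<delta>_def)
  moreover have "diagmat y + t *\<^sub>R W \<in> Ky_Fan_body x" if t: "\<bar>t\<bar> \<le> \<delta>" for t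
  proof -
    define Z where "Z = diagmat y + t *\<^sub>R W"
    have Zsym: "symmetric_matrix Z"
      using symmetric_matrix_combination[OF symmetric_diagmat W(1), of 1 y t] by (simp add: Z_def)
    have W': "W $ i $ j = 0" if "j \<notin> B" for i j
    proof -
      have "W $ i $ j = transpose W $ j $ i" by (simp add: transpose_def)
      then show ?thesis using W(1) W(2)[OF that, of i] by (simp add: symmetric_matrix_def)
    qed
    have Zv: "Z *v u = diagmat y *v u + t *\<^sub>R (W *v u)" for u
      by (simp add: Z_def matrix_vector_mult_add_rdistrib scaleR_matrix_vector_assoc)
    define E where "E = {u :: real^'n. \<forall>i. i \<notin> B \<longrightarrow> u $ i = 0}"
    have "subspace E" by (auto simp: E_def subspace_def)
    moreover have "(W *v u) $ i = 0" if "i \<notin> B" for i u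
      using W(2)[OF that] by (simp add: matrix_vector_mult_def)
    then have "Z *v u \<in> E" if "u \<in> E" for u
      using that by (simp add: E_def Zv diagmat_mult_vec)
    moreover have "dim E = card B" unfolding E_def by (rule dim_coordinate_subspace)
    ultimately obtain v c where v: "\<And>i. i \<in> B \<Longrightarrow> v i \<in> E" "\<And>i. i \<in> B \<Longrightarrow> Z *v v i = c i *\<^sub>R v i"
      "\<And>i j. i \<in> B \<Longrightarrow> j \<in> B \<Longrightarrow> v i \<bullet> v j = (if i = j then 1 else 0)"
      using orthonormal_eigenbasis_of_subspace[OF Zsym finite, of E B] by blast
    define v' c' where "v' = (\<lambda>i. if i \<in> B then v i else axis i 1)"
      and "c' = (\<lambda>i. if i \<in> B then c i else y $ i)"
    have eig: "Z *v v' i = c' i *\<^sub>R v' i" for i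
    proof (cases "i \<in> B")
      case False
      have "W *v axis i 1 = 0"
        using W'[OF False] by (simp add: vec_eq_iff matrix_vector_mult_def axis_def if_distrib[of "\<lambda>z. _ * z"] cong: if_cong)
      moreover have "diagmat y *v axis i 1 = y $ i *\<^sub>R axis i 1"
        by (simp add: vec_eq_iff diagmat_mult_vec axis_def)
      ultimately show ?thesis using False by (simp add: Zv v'_def c'_def)
    qed (simp add: v v'_def c'_def)
    have on: "v' i \<bullet> v' j = (if i = j then 1 else 0)" for i j
      using v(1)[of i] v(1)[of j] v(3)[of i j]
      by (cases "i \<in> B"; cases "j \<in> B") (auto simp: v'_def E_def inner_axis inner_axis', simp_all add: axis_def)
    define V where "V = (\<chi> a i. v' i $ a)"
    have V: "orthogonal_matrix V" "Z = conjugate V (diagmat (\<chi> i. c' i))"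
      using orthonormal_eigenbasis_decomposition[of Z v' c', OF eig on] by (simp_all add: V_def)
    have csum: "(\<Sum>i\<in>UNIV. c' i) = (\<Sum>i\<in>UNIV. y $ i)"
    proof -
      have "(\<Sum>i\<in>UNIV. c' i) = trace Z"
        using trace_conjugate[OF V(1), of "diagmat (\<chi> i. c' i)"] V(2) by (simp add: trace_def diagmat_def)
      also have "\<dots> = (\<Sum>i\<in>UNIV. y $ i) + t * trace W"
        by (simp add: Z_def trace_def diagmat_def sum.distrib sum_distrib_left)
      finally show ?thesis using W(3) by simp
    qed
    have off: "(\<Sum>i\<in>S - B. c' i) = (\<Sum>i\<in>S - B. y $ i)" for S
      by (intro sum.cong) (auto simp: c'_def)
    have split: "(\<Sum>i\<in>S. g i) = (\<Sum>i\<in>S \<inter> B. g i) + (\<Sum>i\<in>S - B. g i)" for S and g :: "'n \<Rightarrow> real"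
      using sum.Int_Diff[of S g B] by simp
    have maj_le: "(\<Sum>i\<in>S. y $ i) \<le> topsum x (card S)" for S using maj by (simp add: majorized_def)
    have "(\<Sum>i\<in>S. c' i) \<le> topsum x (card S)" for S
    proof -
      consider "S \<inter> B = {}" | "B \<subseteq> S" | "S \<inter> B \<noteq> {}" "\<not> B \<subseteq> S" by blast
      then show ?thesis
      proof cases
        case 1
        then show ?thesis using split[of c' S] split[of "\<lambda>i. y $ i" S] off[of S] maj_le[of S] by simp
      next
        case 2
        have "(\<Sum>i\<in>B. c' i) = (\<Sum>i\<in>B. y $ i)"
          using split[of c' UNIV] split[of "\<lambda>i. y $ i" UNIV] off[of UNIV] csum by simp
        moreover have "S \<inter> B = B" using 2 by blast
        ultimately show ?thesis using split[of c' S] split[of "\<lambda>i. y $ i" S] off[of S] maj_le[of S] by simp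
      next
        case 3
        define w where "w = (\<lambda>j. \<Sum>i\<in>S \<inter> B. (v i $ j)\<^sup>2)"
        have c: "c i \<le> (\<Sum>j\<in>B. (v i $ j)\<^sup>2 * y $ j) + \<delta> * K" if i: "i \<in> B" for i
        proof -
          have n1: "norm (v i) = 1" using v(3)[OF i i] by (simp add: norm_eq_sqrt_inner)
          have "c i = v i \<bullet> (Z *v v i)" using v(2,3) i by simp
          also have "\<dots> = v i \<bullet> (diagmat y *v v i) + t * (v i \<bullet> (W *v v i))"
            by (simp add: Zv inner_add_right)
          also have "v i \<bullet> (diagmat y *v v i) = (\<Sum>j\<in>UNIV. (v i $ j)\<^sup>2 * y $ j)"
            by (simp add: inner_vec_def diagmat_mult_vec power2_eq_square algebra_simps)
          also have "\<dots> = (\<Sum>j\<in>B. (v i $ j)\<^sup>2 * y $ j)"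
            using v(1)[OF i] by (intro sum.mono_neutral_right) (auto simp: E_def)
          also have "t * (v i \<bullet> (W *v v i)) \<le> \<delta> * K"
          proof -
            have "\<bar>v i \<bullet> (W *v v i)\<bar> \<le> K"
              using Cauchy_Schwarz_ineq2[of "v i" "W *v v i"] K(2)[of "v i"] n1 by simp
            then have "\<bar>t * (v i \<bullet> (W *v v i))\<bar> \<le> \<delta> * K"
              unfolding abs_mult using t by (intro mult_mono) auto
            then show ?thesis by simp
          qed
          finally show ?thesis by simp
        qed
        have "\<exists>T\<subseteq>B. card T = card (S \<inter> B) \<and> (\<Sum>j\<in>B. w j * y $ j) \<le> (\<Sum>j\<in>T. y $ j)"
        proof (rule fractional_knapsack_ex)
          show "0 \<le> w j \<and> w j \<le> 1" for j
          proof -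
            have "w j = (\<Sum>i\<in>S \<inter> B. (V $ j $ i)\<^sup>2)"
              unfolding w_def by (intro sum.cong) (auto simp: V_def v'_def)
            also have "\<dots> \<le> (\<Sum>i\<in>UNIV. (V $ j $ i)\<^sup>2)" by (intro sum_mono2) auto
            finally show ?thesis
              using orthogonal_matrix_square_sums(1)[OF V(1)] by (simp add: w_def sum_nonneg)
          qed
          have "(\<Sum>j\<in>B. (v i $ j)\<^sup>2) = 1" if i: "i \<in> B" for i
          proof -
            have "(\<Sum>j\<in>B. (v i $ j)\<^sup>2) = (\<Sum>j\<in>UNIV. (v i $ j)\<^sup>2)"
              using v(1)[OF i] by (intro sum.mono_neutral_left) (auto simp: E_def)
            also have "\<dots> = v i \<bullet> v i" by (simp add: inner_vec_def power2_eq_square)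
            finally show ?thesis using v(3)[OF i i] by simp
          qed
          then show "sum w B = real (card (S \<inter> B))"
            unfolding w_def by (subst sum.swap) simp
        qed simp
        then obtain T where T: "T \<subseteq> B" "card T = card (S \<inter> B)"
          "(\<Sum>j\<in>B. w j * y $ j) \<le> (\<Sum>j\<in>T. y $ j)" by blast
        \<comment> \<open>A set of the same size as \<open>S\<close> that still cuts \<open>B\<close>, whence the gap applies to it.\<close>
        define S' where "S' = T \<union> (S - B)"
        have disj: "T \<inter> (S - B) = {}" using T(1) by blast
        have "card S' = card T + card (S - B)" unfolding S'_def using disj by (intro card_Un_disjoint) auto
        also have "\<dots> = card S" using T(2) card_Int_Diff[of S B] by simp
        finally have cS': "card S' = card S" .
        have "card (S \<inter> B) < card B" using 3 by (intro psubset_card_mono) auto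
        then have "T \<noteq> B" using T(2) by auto
        then have "\<not> B \<subseteq> S'" using T(1) by (auto simp: S'_def)
        moreover have "T \<noteq> {}" using T(2) 3 by (metis card.empty card_eq_0_iff finite)
        then have "S' \<inter> B \<noteq> {}" using T(1) by (auto simp: S'_def)
        ultimately have g: "(\<Sum>i\<in>S'. y $ i) + \<epsilon> \<le> topsum x (card S)" using gap[of S'] cS' by simp
        have "(\<Sum>i\<in>S \<inter> B. c' i) = (\<Sum>i\<in>S \<inter> B. c i)" by (intro sum.cong) (auto simp: c'_def)
        also have "\<dots> \<le> (\<Sum>i\<in>S \<inter> B. (\<Sum>j\<in>B. (v i $ j)\<^sup>2 * y $ j) + \<delta> * K)"
          by (intro sum_mono c) auto
        also have "\<dots> = (\<Sum>j\<in>B. w j * y $ j) + card (S \<inter> B) * (\<delta> * K)"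
          unfolding sum.distrib w_def sum_distrib_right by (subst sum.swap) simp
        also have "card (S \<inter> B) * (\<delta> * K) \<le> CARD('n) * (\<delta> * K)"
          using \<open>0 < \<delta>\<close> K by (intro mult_right_mono) (auto simp: card_mono)
        also have "CARD('n) * (\<delta> * K) = \<epsilon>" using K by (simp add: \<delta>_def)
        finally have "(\<Sum>i\<in>S \<inter> B. c' i) \<le> (\<Sum>j\<in>T. y $ j) + \<epsilon>" using T(3) by simp
        moreover have "(\<Sum>i\<in>S'. y $ i) = (\<Sum>j\<in>T. y $ j) + (\<Sum>i\<in>S - B. y $ i)"
          unfolding S'_def using disj by (intro sum.union_disjoint) auto
        ultimately show ?thesis using g split[of c' S] off[of S] by simp
      qed
    qed
    then have "majorized (\<chi> i. c' i) x" using csum maj by (simp add: majorized_def)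
    then have "Z \<in> Ky_Fan_body x" using conjugate_diagmat_in_Ky_Fan_body[OF V(1)] V(2) by simp
    then show ?thesis by (simp add: Z_def)
  qed
  ultimately show thesis by (rule that)
qed

text \<open>
  Dimension count: \<open>dim V\<close> and the dimension of the orthogonal complement of \<open>G\<close> add up to more than
  that of the whole space.
\<close>

lemma subspace_meets_orthogonal_complement:
  fixes V G :: "'a::euclidean_space set"
  assumes "subspace V" "dim G < dim V"
  obtains w where "w \<in> V" "w \<noteq> 0" "\<And>g. g \<in> G \<Longrightarrow> g \<bullet> w = 0"
proof -
  define C where "C = {w. \<forall>g\<in>span G. orthogonal g w}"
  have "subspace C" unfolding C_def by (rule subspace_orthogonal_to_vectors)
  have "dim C + dim (span G) = DIM('a)"
    using dim_subspace_orthogonal_to_vectors[of "span G" "UNIV :: 'a set"] by (simp add: C_def)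
  moreover have "dim {x + y |x y. x \<in> V \<and> y \<in> C} + dim (V \<inter> C) = dim V + dim C"
    using dim_sums_Int[OF \<open>subspace V\<close> \<open>subspace C\<close>] .
  moreover have "dim {x + y |x y. x \<in> V \<and> y \<in> C} \<le> DIM('a)" by (rule dim_subset_UNIV)
  ultimately have "dim (V \<inter> C) \<noteq> 0" using assms(2) unfolding dim_span by linarith
  then obtain w where "w \<in> V \<inter> C" "w \<noteq> 0" by (metis dim_eq_0 subsetI singletonI)
  then show thesis by (intro that[of w]) (auto simp: C_def orthogonal_def span_base)
qed

text \<open>
  The symmetric matrices supported on \<open>B \<times> B\<close> have dimension \<open>b (b + 1) / 2\<close> with \<open>b = card B\<close>. An orthogonal basis
  is indexed by the nonempty subsets \<open>{i, j}\<close> of \<open>B\<close> of size at most two.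
\<close>

lemma symmetric_block_matrix_orthogonal:
  fixes B :: "'n::finite set" and G :: "(real^'n^'n) set"
  assumes "2 * dim G < card B * (card B + 1)"
  obtains W where "W \<noteq> 0" "symmetric_matrix W" "\<And>i j. i \<notin> B \<Longrightarrow> W $ i $ j = 0" "\<And>g. g \<in> G \<Longrightarrow> g \<bullet> W = 0"
proof -
  define M :: "'n set \<Rightarrow> real^'n^'n" where "M = (\<lambda>p. \<chi> i j. if {i, j} = p then 1 else 0)"
  define Ps where "Ps = {p. p \<subseteq> B \<and> card p = 1} \<union> {p. p \<subseteq> B \<and> card p = 2}"
  have "card Ps = card {p. p \<subseteq> B \<and> card p = 1} + card {p. p \<subseteq> B \<and> card p = 2}"
    unfolding Ps_def by (intro card_Un_disjoint) auto
  also have "\<dots> = card B + (card B choose 2)" by (simp add: n_subsets)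
  finally have "2 * card Ps = card B * (card B + 1)"
    by (cases "card B") (simp_all add: choose_two algebra_simps)
  have form: "\<exists>i j. p = {i, j} \<and> i \<in> B \<and> j \<in> B" if "p \<in> Ps" for p
    using that by (auto simp: Ps_def card_1_singleton_iff card_2_iff)
  have orth: "M p \<bullet> M q = 0" if "p \<noteq> q" for p q
  proof -
    have "M p $ i $ j * M q $ i $ j = 0" for i j using that by (auto simp: M_def)
    then show ?thesis by (simp only: inner_vec_def inner_real_def sum.neutral_const)
  qed
  have nz: "M p \<noteq> 0" if p: "p \<in> Ps" for p
  proof -
    obtain i j where "p = {i, j}" using form[OF p] by blast
    then have "M p $ i $ j = 1" by (simp add: M_def)
    then show ?thesis by auto
  qed
  have inj: "inj_on M Ps"
  proof (rule inj_onI, rule ccontr)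
    fix p q assume "p \<in> Ps" "M p = M q" "p \<noteq> q"
    then show False using orth[of p q] nz[of p] by simp
  qed
  have "independent (M ` Ps)"
  proof (rule pairwise_orthogonal_independent)
    show "pairwise orthogonal (M ` Ps)"
      unfolding pairwise_def orthogonal_def using orth by (metis imageE)
    show "0 \<notin> M ` Ps" using nz by force
  qed
  then have "dim (span (M ` Ps)) = card Ps"
    using card_image[OF inj] by (simp add: dim_eq_card_independent)
  then have "dim G < dim (span (M ` Ps))" using \<open>2 * card Ps = _\<close> assms by simp
  then obtain W where W: "W \<in> span (M ` Ps)" "W \<noteq> 0" "\<And>g. g \<in> G \<Longrightarrow> g \<bullet> W = 0"
    using subspace_meets_orthogonal_complement[OF subspace_span] by metis
  define L where "L = {W :: real^'n^'n. \<forall>i j. W $ i $ j = W $ j $ i \<and> (i \<notin> B \<longrightarrow> W $ i $ j = 0)}"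
  have "M ` Ps \<subseteq> L" using form by (fastforce simp: M_def L_def insert_commute doubleton_eq_iff)
  moreover have "subspace L" by (auto simp: L_def subspace_def)
  ultimately have "W \<in> L" using W(1) span_minimal by blast
  then show thesis
    using W by (intro that[of W]) (auto simp: L_def symmetric_matrix_def transpose_def vec_eq_iff)
qed

text \<open>
  In an eigenbasis of \<open>X\<close> the slack block \<open>B\<close> has at least \<open>k - r + 2\<close> elements. The matrices
  supported on this block are therefore numerous enough to contain a nonzero one that is orthogonal to the
  constraints in \<open>G\<close> and to the identity; the latter keeps the trace.
\<close>

lemma high_rank_segment_in_Ky_Fan_body:
  fixes x :: "real^'n" and X :: "real^'n^'n"
  assumes X: "X \<in> Ky_Fan_body x" and x: "\<And>i. 0 \<le> x $ i" "card {i. x $ i \<noteq> 0} \<le> r"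
    and rk: "r \<le> k" "k < rank X" and G: "2 * (dim G + 1) < (k - r + 2) * (k - r + 3)"
  obtains Y where "Y \<noteq> 0" "X + Y \<in> Ky_Fan_body x" "X - Y \<in> Ky_Fan_body x" "\<And>g. g \<in> G \<Longrightarrow> g \<bullet> Y = 0"
proof -
  obtain Q y where Q: "orthogonal_matrix Q" "X = conjugate Q (diagmat y)" "majorized y x"
    using X by (rule Ky_Fan_body_spectral)
  have card_y: "card {i. y $ i \<noteq> 0} = rank X" using Q by (simp add: rank_conjugate rank_diagmat)
  then have "r < card {i. y $ i \<noteq> 0}" using rk by simp
  then obtain B where B: "card {i. y $ i \<noteq> 0} < card B + r"
    "\<And>S. S \<inter> B \<noteq> {} \<Longrightarrow> \<not> B \<subseteq> S \<Longrightarrow> (\<Sum>i\<in>S. y $ i) < topsum x (card S)"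
    using slack_block_exists[OF Q(3) x] by blast
  \<comment> \<open>The constraints in the eigenbasis of \<open>X\<close>, together with the trace.\<close>
  define G' where "G' = insert (mat 1) (conjugate (transpose Q) ` G)"
  have "dim (conjugate (transpose Q) ` G) \<le> dim G" by (rule dim_image_le[OF linear_conjugate])
  then have "dim G' \<le> dim G + 1" by (simp add: G'_def dim_insert)
  then have "2 * dim G' \<le> 2 * (dim G + 1)" by simp
  also note G
  also have "(k - r + 2) * (k - r + 3) \<le> card B * (card B + 1)"
    using B(1) card_y rk by (intro mult_le_mono) auto
  finally have "2 * dim G' < card B * (card B + 1)" .
  then obtain W where W: "W \<noteq> 0" "symmetric_matrix W" "\<And>i j. i \<notin> B \<Longrightarrow> W $ i $ j = 0" "\<And>g. g \<in> G' \<Longrightarrow> g \<bullet> W = 0"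
    by (rule symmetric_block_matrix_orthogonal) blast
  have "trace W = mat 1 \<bullet> W" by (simp add: inner_matrix_eq_trace)
  then have "trace W = 0" using W(4) by (simp add: G'_def)
  from block_perturbation_in_Ky_Fan_body[OF Q(3) B(2) W(2,3) this]
  obtain \<delta> where \<delta>: "0 < \<delta>" "\<And>t. \<bar>t\<bar> \<le> \<delta> \<Longrightarrow> diagmat y + t *\<^sub>R W \<in> Ky_Fan_body x" by blast
  have inK: "X + t *\<^sub>R conjugate Q W \<in> Ky_Fan_body x" if "\<bar>t\<bar> \<le> \<delta>" for t
    using conjugate_in_Ky_Fan_body[OF Q(1) \<delta>(2)[OF that]] Q(2)
    by (simp add: linear_add[OF linear_conjugate] linear_scale[OF linear_conjugate])
  show thesis
  proof (rule that[of "\<delta> *\<^sub>R conjugate Q W"])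
    have "norm (conjugate Q W) \<noteq> 0" using W(1) norm_conjugate[OF Q(1)] by simp
    then show "\<delta> *\<^sub>R conjugate Q W \<noteq> 0" using \<delta>(1) by simp
    show "X + \<delta> *\<^sub>R conjugate Q W \<in> Ky_Fan_body x" using inK[of \<delta>] \<delta>(1) by simp
    show "X - \<delta> *\<^sub>R conjugate Q W \<in> Ky_Fan_body x" using inK[of "- \<delta>"] \<delta>(1) by simp
    show "g \<bullet> (\<delta> *\<^sub>R conjugate Q W) = 0" if "g \<in> G" for g
      using W(4)[of "conjugate (transpose Q) g"] that by (simp add: G'_def inner_conjugate)
  qed
qed

section \<open>Exactness of the relaxation\<close>

lemma not_extreme_point_if_segment:
  assumes "Y \<noteq> 0" "X + Y \<in> S" "X - Y \<in> S"
  shows "\<not> X extreme_point_of S"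
proof
  assume "X extreme_point_of S"
  moreover have "X \<in> open_segment (X - Y) (X + Y)"
    using assms(1) by (auto simp: in_segment algebra_simps intro!: exI[of _ "1/2"] simp flip: scaleR_add_left scaleR_2)
  ultimately show False using assms by (auto simp: extreme_point_of_def)
qed

lemma feasible_set_eq_Int: "feasible_set S A bl bu m = S \<inter> feasible_set UNIV A bl bu m"
  by (auto simp: feasible_set_def)

lemma feasible_set_UNIV_eq_INT:
  "feasible_set UNIV A bl bu m = (\<Inter>i\<in>{1..m}. {X. bl i \<le> ereal (A i \<bullet> X)} \<inter> {X. ereal (A i \<bullet> X) \<le> bu i})"
  by (auto simp: feasible_set_def)

lemma closed_feasible_set: "closed (feasible_set UNIV A bl bu m)"
  unfolding feasible_set_UNIV_eq_INT
  by (intro closed_INT ballI closed_Int closed_Collect_le continuous_intros continuous_on_ereal)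

lemma convex_feasible_set: "convex (feasible_set UNIV A bl bu m)"
proof -
  have cl: "convex {X. b \<le> ereal (C \<bullet> X)}" and cu: "convex {X. ereal (C \<bullet> X) \<le> b}" for b and C :: "real^'n^'n"
  proof -
    show "convex {X. b \<le> ereal (C \<bullet> X)}"
      by (cases b) (simp_all add: convex_halfspace_ge)
    show "convex {X. ereal (C \<bullet> X) \<le> b}"
      by (cases b) (simp_all add: convex_halfspace_le)
  qed
  show ?thesis unfolding feasible_set_UNIV_eq_INT by (intro convex_INT convex_Int cl cu)
qed

theorem proposition2:
  fixes f :: "real^'n \<Rightarrow> real"
    and A :: "nat \<Rightarrow> real^'n^'n"
    and bl bu :: "nat \<Rightarrow> ereal"
    and k m :: nat
  defines "D \<equiv> spectral_domain f k"
    and "kt \<equiv> strengthened_rank f k"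
    and "mt \<equiv> dim (span (A ` {1..m}))"
  assumes "1 \<le> k" and "k \<le> CARD('n)"
    and "continuous_on UNIV f" and "convex_on UNIV f" and "symmetric_function f"
    and "\<And>i. i \<le> m \<Longrightarrow> symmetric_matrix (A i)"
    and "\<And>i. 1 \<le> i \<Longrightarrow> i \<le> m \<Longrightarrow> bl i \<le> bu i"
    and "real mt \<le> (real k - real kt + 2) * (real k - real kt + 3) / 2 - 2"
  shows "(\<forall>X. X extreme_point_of feasible_set (convex hull D) A bl bu m \<longrightarrow> rank X \<le> k)
       \<and> (optimal_value (convex hull D) A bl bu m > -\<infinity> \<longrightarrow>
            optimal_value D A bl bu m = optimal_value (convex hull D) A bl bu m)"
proof -
  note f = \<open>convex_on UNIV f\<close> \<open>symmetric_function f\<close>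
  have "kt \<le> k \<and> convex hull spectral_domain f k = convex hull spectral_domain f kt"
    unfolding kt_def strengthened_rank_def by (rule LeastI2[of _ k]) (use \<open>1 \<le> k\<close> in auto)
  then have kt: "kt \<le> k" and hull: "convex hull D = convex hull spectral_domain f kt"
    by (simp_all add: D_def)
  let ?F = "feasible_set UNIV A bl bu m"
  let ?G = "A ` {1..m}"
  have "real (2 * (mt + 1)) < real ((k - kt + 2) * (k - kt + 3))"
  proof -
    define s where "s = k - kt"
    have "real k - real kt = real s" using kt by (simp add: s_def of_nat_diff)
    then have "real mt \<le> (real s + 2) * (real s + 3) / 2 - 2" using assms(11) by simp
    then show ?thesis unfolding s_def[symmetric] by (simp add: algebra_simps)
  qed
  then have G: "2 * (dim ?G + 1) < (k - kt + 2) * (k - kt + 3)"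
    by (simp only: of_nat_less_iff mt_def dim_span)
  have shift: "X + Y \<in> ?F" if "X \<in> ?F" "\<And>g. g \<in> ?G \<Longrightarrow> g \<bullet> Y = 0" for X Y
    using that by (simp add: feasible_set_def inner_add_right)
  \<comment> \<open>Used with \<open>S\<close> the whole convex hull of \<open>D\<close> for the first claim, and with \<open>S = Ky_Fan_body x\<close> for the second.\<close>
  have low_rank: "rank X \<le> k"
    if x: "x \<in> sparse_feasible_vectors f kt" and X: "X \<in> Ky_Fan_body x" "X extreme_point_of S \<inter> ?F"
      and S: "Ky_Fan_body x \<subseteq> S" for x X S
  proof (rule ccontr)
    assume "\<not> rank X \<le> k"
    then obtain Y where Y: "Y \<noteq> 0" "X + Y \<in> Ky_Fan_body x" "X - Y \<in> Ky_Fan_body x"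
      "\<And>g. g \<in> ?G \<Longrightarrow> g \<bullet> Y = 0"
      using high_rank_segment_in_Ky_Fan_body[OF X(1) _ _ kt _ G] x
      by (auto simp: sparse_feasible_vectors_def)
    have "X \<in> ?F" using X(2) by (simp add: extreme_point_of_def)
    then have "X + Y \<in> ?F" "X - Y \<in> ?F" using shift[of X Y] shift[of X "- Y"] Y(4) by simp_all
    then have "X + Y \<in> S \<inter> ?F" "X - Y \<in> S \<inter> ?F" using Y(2,3) S by auto
    then show False using not_extreme_point_if_segment[OF Y(1)] X(2) by metis
  qed
  have bodies: "\<exists>x\<in>sparse_feasible_vectors f kt. X \<in> Ky_Fan_body x \<and> Ky_Fan_body x \<subseteq> convex hull D"
    if "X \<in> convex hull D" for X
    using that hull_subset_Ky_Fan_bodies[OF f] Ky_Fan_body_subset_hull[OF f(2)] unfolding hull by blast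
  have "rank X \<le> k" if X: "X extreme_point_of feasible_set (convex hull D) A bl bu m" for X
  proof -
    have "X \<in> convex hull D" using X by (simp add: extreme_point_of_def feasible_set_def)
    then obtain x where "x \<in> sparse_feasible_vectors f kt" "X \<in> Ky_Fan_body x" "Ky_Fan_body x \<subseteq> convex hull D"
      using bodies by blast
    then show ?thesis using low_rank[of x X "convex hull D"] X feasible_set_eq_Int[of "convex hull D"] by simp
  qed
  moreover have "optimal_value D A bl bu m = optimal_value (convex hull D) A bl bu m"
  proof (rule antisym)
    show "optimal_value (convex hull D) A bl bu m \<le> optimal_value D A bl bu m"
      unfolding optimal_value_def by (rule INF_superset_mono) (auto simp: feasible_set_def hull_inc)
    show "optimal_value D A bl bu m \<le> optimal_value (convex hull D) A bl bu m"
      unfolding optimal_value_def[of "convex hull D"]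
    proof (rule INF_greatest)
      fix X assume X: "X \<in> feasible_set (convex hull D) A bl bu m"
      then have "X \<in> convex hull D" "X \<in> ?F" by (auto simp: feasible_set_def)
      then obtain x where x: "x \<in> sparse_feasible_vectors f kt" "X \<in> Ky_Fan_body x" using bodies by blast
      \<comment> \<open>A compact part of the relaxed feasible set through \<open>X\<close>, on which the objective attains its minimum.\<close>
      define S where "S = Ky_Fan_body x \<inter> ?F"
      have S: "compact S" "convex S" "X \<in> S"
        using x \<open>X \<in> ?F\<close> unfolding S_def
        by (auto intro: compact_Int_closed compact_Ky_Fan_body closed_feasible_set
            convex_Int convex_Ky_Fan_body convex_feasible_set)
      have "continuous_on S (\<lambda>Z. A 0 \<bullet> Z)" by (intro continuous_intros)
      then obtain Z0 where Z0: "Z0 \<in> S" "\<And>Z. Z \<in> S \<Longrightarrow> A 0 \<bullet> Z0 \<le> A 0 \<bullet> Z"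
        using continuous_attains_inf[of S "\<lambda>Z. A 0 \<bullet> Z"] S by blast
      \<comment> \<open>The optimal face of \<open>S\<close>; its extreme points are extreme in \<open>S\<close>.\<close>
      define M where "M = S \<inter> {Z. A 0 \<bullet> Z = A 0 \<bullet> Z0}"
      have face: "M face_of S"
        unfolding M_def using Z0(2) S(2) by (intro face_of_Int_supporting_hyperplane_ge)
      have "compact M" unfolding M_def using S(1) by (intro compact_Int_closed closed_hyperplane)
      moreover have "convex M" "M \<noteq> {}" using face face_of_imp_convex Z0(1) by (auto simp: M_def)
      ultimately obtain Z where "Z extreme_point_of M" using extreme_point_exists_convex by blast
      then have Z: "Z extreme_point_of S" "Z \<in> M" using extreme_point_of_face[OF face] by auto
      have ZK: "Z \<in> Ky_Fan_body x" "Z \<in> ?F" "A 0 \<bullet> Z \<le> A 0 \<bullet> X"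
        using Z(2) Z0(2)[OF S(3)] by (auto simp: M_def S_def)
      have "rank Z \<le> k" using low_rank[OF x(1) ZK(1) Z(1)[unfolded S_def]] by simp
      then have "Z \<in> D" unfolding D_def by (rule low_rank_in_Ky_Fan_body[OF f x(1) ZK(1)])
      then have "Z \<in> feasible_set D A bl bu m" using ZK(2) by (simp add: feasible_set_def)
      then have "optimal_value D A bl bu m \<le> ereal (A 0 \<bullet> Z)" unfolding optimal_value_def by (rule INF_lower)
      then show "optimal_value D A bl bu m \<le> ereal (A 0 \<bullet> X)" using ZK(3) by (simp add: order_trans)
    qed
  qed
  ultimately show ?thesis by blast
qed

end
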